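(* Let $(M^2,[g],[\mathrm{P}])$ be a Möbius surface. The map sending a section $I_A$ of the standard tractor bundle $\mathcal{E}_A$ to its scale $\sigma=X^AI_A$ restricts to a one-to-one correspondence between the sections $I_A$ of $\mathcal{E}_A$ that are parallel with respect to the prolongation connection $D_a$ (i.e. $D_aI_B=0$) and have nowhere vanishing $\sigma=X^AI_A$, and the nowhere vanishing solutions $\sigma$ (of conformal weight $1$) of the conformal Einstein equation $$\text{trace-free part of }\big(\nabla_a\nabla_b\sigma+\mathrm{P}_{ab}\sigma\big)=0 .$$
   Context: Everything is smooth. A Möbius surface $(M^2,[g],[\mathrm P])$ is an oriented $2$-manifold with a conformal class $[g]$ of Riemannian metrics together with an assignment to each $g_{ab}\in[g]$ of a symmetric tensor $\mathrm P_{ab}$ such that $g^{ab}\mathrm P_{ab}=K$, where $K$ is the Gauss curvature of $g$, and such that for $\hat g_{ab}=\Omega^2g_{ab}$ ($\Omega>0$ smooth) with $\Upsilon_a=\nabla_a\log\Omega$, $$\hat{\mathrm P}_{ab}=\mathrm P_{ab}-\nabla_a\Upsilon_b+\Upsilon_a\Upsilon_b-\tfrac12 g_{ab}\Upsilon_c\Upsilon^c .$$ $\nabla$ is the Levi-Civita connection of the chosen representative $g$; indices are raised and lowered with $g$; $\epsilon_{ab}$ is the volume form of $g$, normalised by $\epsilon^{ab}\epsilon_{cb}=\delta_c{}^a$. A density $\sigma$ of weight $1$ (section of $\mathcal E[1]$) is represented, for each choice of $g\in[g]$, by a function $\sigma$, with $\hat\sigma=\Omega\sigma$ under $\hat g=\Omega^2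 g$; the equation in the claim is then conformally invariant, i.e. it holds for one representative iff it holds for all. Set $Y_{abc}=\nabla_a\mathrm P_{bc}-\nabla_b\mathrm P_{ac}$, $Y_c=\epsilon^{ab}Y_{abc}$, $U_a=\epsilon_{ac}Y^c$. The standard tractor bundle $\mathcal E_A$ is the rank $4$ bundle which for each choice $g\in[g]$ is identified with $\mathcal E[1]\oplus\mathcal E_a[1]\oplus\mathcal E[-1]$ (where $\mathcal E_a$ is the bundle of $1$-forms and $[w]$ denotes weight $w$). A section is thus a triple $T_A=(\sigma,\mu_b,\Lambda)$, and for $\hat g=\Omega^2g$ the triple becomes $(\sigma,\ \mu_b+\Upsilon_b\sigma,\ \Lambda-\Upsilon^b\mu_b-\tfrac12\Upsilon_b\Upsilon^b\sigma)$ (as weighted quantities). $X^AT_A=\sigma$ denotes the first slot. The prolongation connection is $$D_a\begin{pmatrix}\sigma\\ \mu_b\\ \Lambda\end{pmatrix}=\begin{pmatrix}\nabla_a\sigma-\mu_a\\ \nabla_a\mu_b+\mathrm P_{ab}\sigma+\Lambda g_{ab}\\ \nabla_a\Lambda-\mathrm P_{ad}\mu^d+\tfrac12U_a\sigma\end{pmatrix}.$$ *)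

theory Defs
  imports "HOL-Analysis.Analysis"
begin

section \<open>Smooth functions on open subsets of normed spaces\<close>

text \<open>The derivative is the one at a point of the whole space, so the predicates are meant for
  open sets; in finite dimension they then say that all iterated partial derivatives up to
  order \<open>k\<close> exist and are continuous.\<close>

fun Ck_on :: "nat \<Rightarrow> 'a::real_normed_vector set \<Rightarrow> ('a \<Rightarrow> 'b::real_normed_vector) \<Rightarrow> bool" where
  "Ck_on 0 S f \<longleftrightarrow> continuous_on S f"
| "Ck_on (Suc k) S f \<longleftrightarrow> (\<forall>x\<in>S. f differentiable (at x)) \<and>
     (\<forall>v. Ck_on k S (\<lambda>x. frechet_derivative f (at x) v))"

definition smooth_on :: "'a::real_normed_vector set \<Rightarrow> ('a \<Rightarrow> 'b::real_normed_vector) \<Rightarrow> bool" where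
  "smooth_on S f \<longleftrightarrow> (\<forall>k. Ck_on k S f)"


section \<open>Oriented surfaces\<close>

text \<open>A chart is an open set together with a coordinate map, of which only the values on that set
  matter. The surface is the whole type \<open>'m\<close>.\<close>

type_synonym 'm chart = "'m set \<times> ('m \<Rightarrow> real^2)"

definition chart_inv :: "'m chart \<Rightarrow> real^2 \<Rightarrow> 'm" where
  "chart_inv c = inv_into (fst c) (snd c)"

definition jacobian :: "'m chart \<Rightarrow> 'm chart \<Rightarrow> 'm \<Rightarrow> real^2^2" where
  "jacobian c d p = matrix (frechet_derivative (snd d \<circ> chart_inv c) (at (snd c p)))"

locale oriented_surface =
  fixes A :: "'m::{t2_space,second_countable_topology} chart set"
  assumes charts: "c \<in> A \<Longrightarrow> open (fst c) \<and> open (snd c ` fst c) \<and>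
      homeomorphism (fst c) (snd c ` fst c) (snd c) (chart_inv c)"
    and covering: "\<Union> (fst ` A) = UNIV"
    and transition_smooth: "c \<in> A \<Longrightarrow> d \<in> A \<Longrightarrow>
      smooth_on (snd c ` (fst c \<inter> fst d)) (snd d \<circ> chart_inv c)"
    and transition_oriented: "c \<in> A \<Longrightarrow> d \<in> A \<Longrightarrow> p \<in> fst c \<inter> fst d \<Longrightarrow>
      det (jacobian c d p) > 0"


section \<open>Smooth tensor fields\<close>

definition smooth_in_chart :: "'m chart \<Rightarrow> ('m \<Rightarrow> real) \<Rightarrow> bool" where
  "smooth_in_chart c f \<longleftrightarrow> smooth_on (snd c ` fst c) (f \<circ> chart_inv c)"

definition smooth_fun :: "'m chart set \<Rightarrow> ('m \<Rightarrow> real) \<Rightarrow> bool" where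
  "smooth_fun A f \<longleftrightarrow> (\<forall>c\<in>A. smooth_in_chart c f)"

text \<open>Tensor fields are families of component functions, one for every chart of the atlas, that are
  related by the tensor transformation law. So that every tensor field has exactly one
  representation, the components are set to \<open>0\<close> at arguments where they have no meaning, i.e. for
  charts outside the atlas and points outside the chart domain.\<close>

type_synonym 'm covector_field = "'m chart \<Rightarrow> 'm \<Rightarrow> real^2"
type_synonym 'm bilinear_field = "'m chart \<Rightarrow> 'm \<Rightarrow> real^2^2"

definition one_form :: "'m chart set \<Rightarrow> 'm covector_field \<Rightarrow> bool" where
  "one_form A \<omega> \<longleftrightarrow>
     (\<forall>c\<in>A. \<forall>a. smooth_in_chart c (\<lambda>p. \<omega> c p $ a)) \<and>
     (\<forall>c\<in>A. \<forall>d\<in>A. \<forall>p\<in>fst c \<inter> fst d. \<forall>a.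
        \<omega> c p $ a = (\<Sum>i\<in>UNIV. jacobian c d p $ i $ a * \<omega> d p $ i)) \<and>
     (\<forall>c p. c \<notin> A \<or> p \<notin> fst c \<longrightarrow> \<omega> c p = 0)"

definition symmetric_tensor :: "'m chart set \<Rightarrow> 'm bilinear_field \<Rightarrow> bool" where
  "symmetric_tensor A T \<longleftrightarrow>
     (\<forall>c\<in>A. \<forall>a b. smooth_in_chart c (\<lambda>p. T c p $ a $ b)) \<and>
     (\<forall>c\<in>A. \<forall>p\<in>fst c. \<forall>a b. T c p $ a $ b = T c p $ b $ a) \<and>
     (\<forall>c\<in>A. \<forall>d\<in>A. \<forall>p\<in>fst c \<inter> fst d. \<forall>a b.
        T c p $ a $ b =
          (\<Sum>i\<in>UNIV. \<Sum>j\<in>UNIV. jacobian c d p $ i $ a * jacobian c d p $ j $ b * T d p $ i $ j)) \<and>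
     (\<forall>c p. c \<notin> A \<or> p \<notin> fst c \<longrightarrow> T c p = 0)"

type_synonym 'm metric = "'m bilinear_field"

definition riemannian_metric :: "'m chart set \<Rightarrow> 'm metric \<Rightarrow> bool" where
  "riemannian_metric A g \<longleftrightarrow> symmetric_tensor A g \<and>
     (\<forall>c\<in>A. \<forall>p\<in>fst c. \<forall>v. v \<noteq> 0 \<longrightarrow> v \<bullet> (g c p *v v) > 0)"


section \<open>Local formulas of Riemannian geometry\<close>

text \<open>All of the following are components with respect to a chart \<open>c\<close> at a point \<open>p\<close> of its domain.\<close>

definition pd :: "'m chart \<Rightarrow> 2 \<Rightarrow> ('m \<Rightarrow> real) \<Rightarrow> 'm \<Rightarrow> real" where
  "pd c a f p = frechet_derivative (f \<circ> chart_inv c) (at (snd c p)) (axis a 1)"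

definition ginv :: "'m metric \<Rightarrow> 'm chart \<Rightarrow> 'm \<Rightarrow> 2 \<Rightarrow> 2 \<Rightarrow> real" where
  "ginv g c p a b = matrix_inv (g c p) $ a $ b"

definition raise :: "'m metric \<Rightarrow> 'm chart \<Rightarrow> 'm \<Rightarrow> (2 \<Rightarrow> real) \<Rightarrow> 2 \<Rightarrow> real" where
  "raise g c p \<omega> a = (\<Sum>b\<in>UNIV. ginv g c p a b * \<omega> b)"

definition trace_wrt :: "'m metric \<Rightarrow> 'm chart \<Rightarrow> 'm \<Rightarrow> (2 \<Rightarrow> 2 \<Rightarrow> real) \<Rightarrow> real" where
  "trace_wrt g c p S = (\<Sum>a\<in>UNIV. \<Sum>b\<in>UNIV. ginv g c p a b * S a b)"

definition trace_free :: "'m metric \<Rightarrow> 'm chart \<Rightarrow> 'm \<Rightarrow> (2 \<Rightarrow> 2 \<Rightarrow> real) \<Rightarrow> 2 \<Rightarrow> 2 \<Rightarrow> real" where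
  "trace_free g c p S a b = S a b - (1/2) * trace_wrt g c p S * g c p $ a $ b"

text \<open>\<open>christoffel g c p e a b\<close> is \<open>\<Gamma>\<^sup>e\<^sub>a\<^sub>b\<close>.\<close>

definition christoffel :: "'m metric \<Rightarrow> 'm chart \<Rightarrow> 'm \<Rightarrow> 2 \<Rightarrow> 2 \<Rightarrow> 2 \<Rightarrow> real" where
  "christoffel g c p e a b = (1/2) * (\<Sum>d\<in>UNIV. ginv g c p e d *
     (pd c a (\<lambda>q. g c q $ b $ d) p + pd c b (\<lambda>q. g c q $ a $ d) p - pd c d (\<lambda>q. g c q $ a $ b) p))"

text \<open>\<open>nabla1 g c \<omega> p a b\<close> is \<open>\<nabla>\<^sub>a\<omega>\<^sub>b\<close> and \<open>nabla2 g c T p a b d\<close> is \<open>\<nabla>\<^sub>aT\<^sub>b\<^sub>d\<close>; the arguments \<open>\<omega>\<close> and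
  \<open>T\<close> are the components in the chart \<open>c\<close>.\<close>

definition nabla1 :: "'m metric \<Rightarrow> 'm chart \<Rightarrow> ('m \<Rightarrow> 2 \<Rightarrow> real) \<Rightarrow> 'm \<Rightarrow> 2 \<Rightarrow> 2 \<Rightarrow> real" where
  "nabla1 g c \<omega> p a b = pd c a (\<lambda>q. \<omega> q b) p - (\<Sum>e\<in>UNIV. christoffel g c p e a b * \<omega> p e)"

definition nabla2 :: "'m metric \<Rightarrow> 'm chart \<Rightarrow> ('m \<Rightarrow> 2 \<Rightarrow> 2 \<Rightarrow> real) \<Rightarrow> 'm \<Rightarrow> 2 \<Rightarrow> 2 \<Rightarrow> 2 \<Rightarrow> real" where
  "nabla2 g c T p a b d = pd c a (\<lambda>q. T q b d) p
     - (\<Sum>e\<in>UNIV. christoffel g c p e a b * T p e d)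
     - (\<Sum>e\<in>UNIV. christoffel g c p e a d * T p b e)"

text \<open>\<open>riemann g c p a b d e\<close> is the \<open>e\<close>-th component of \<open>R(\<partial>\<^sub>a,\<partial>\<^sub>b)\<partial>\<^sub>d\<close>, where
  \<open>R(X,Y) = [\<nabla>\<^sub>X,\<nabla>\<^sub>Y] - \<nabla>\<^sub>[\<^sub>X\<^sub>,\<^sub>Y\<^sub>]\<close>. The round unit sphere has Gauss curvature \<open>1\<close>.\<close>

definition riemann :: "'m metric \<Rightarrow> 'm chart \<Rightarrow> 'm \<Rightarrow> 2 \<Rightarrow> 2 \<Rightarrow> 2 \<Rightarrow> 2 \<Rightarrow> real" where
  "riemann g c p a b d e =
     pd c a (\<lambda>q. christoffel g c q e b d) p - pd c b (\<lambda>q. christoffel g c q e a d) p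
     + (\<Sum>f\<in>UNIV. christoffel g c p e a f * christoffel g c p f b d
              - christoffel g c p e b f * christoffel g c p f a d)"

definition gauss_curvature :: "'m metric \<Rightarrow> 'm chart \<Rightarrow> 'm \<Rightarrow> real" where
  "gauss_curvature g c p = (\<Sum>e\<in>UNIV. g c p $ 1 $ e * riemann g c p 1 2 2 e) / det (g c p)"

definition vol_form :: "'m metric \<Rightarrow> 'm chart \<Rightarrow> 'm \<Rightarrow> 2 \<Rightarrow> 2 \<Rightarrow> real" where
  "vol_form g c p a b =
     (if a = b then 0 else if a = 1 then sqrt (det (g c p)) else - sqrt (det (g c p)))"

definition vol_form_up :: "'m metric \<Rightarrow> 'm chart \<Rightarrow> 'm \<Rightarrow> 2 \<Rightarrow> 2 \<Rightarrow> real" where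
  "vol_form_up g c p a b =
     (\<Sum>d\<in>UNIV. \<Sum>e\<in>UNIV. ginv g c p a d * ginv g c p b e * vol_form g c p d e)"


section \<open>Moebius surfaces\<close>

definition rescale :: "('m \<Rightarrow> real) \<Rightarrow> 'm metric \<Rightarrow> 'm metric" where
  "rescale \<Omega> g = (\<lambda>c p. (\<Omega> p)\<^sup>2 *\<^sub>R g c p)"

definition conformal_factor :: "'m chart set \<Rightarrow> ('m \<Rightarrow> real) \<Rightarrow> bool" where
  "conformal_factor A \<Omega> \<longleftrightarrow> smooth_fun A \<Omega> \<and> (\<forall>p. \<Omega> p > 0)"

definition conformal_class :: "'m chart set \<Rightarrow> 'm metric set \<Rightarrow> bool" where
  "conformal_class A C \<longleftrightarrow>
     (\<exists>g. riemannian_metric A g \<and> C = {rescale \<Omega> g | \<Omega>. conformal_factor A \<Omega>})"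

definition Upsilon :: "('m \<Rightarrow> real) \<Rightarrow> 'm chart \<Rightarrow> 'm \<Rightarrow> 2 \<Rightarrow> real" where
  "Upsilon \<Omega> c p a = pd c a (\<lambda>q. ln (\<Omega> q)) p"

definition Upsilon_sq :: "'m metric \<Rightarrow> ('m \<Rightarrow> real) \<Rightarrow> 'm chart \<Rightarrow> 'm \<Rightarrow> real" where
  "Upsilon_sq g \<Omega> c p = (\<Sum>a\<in>UNIV. Upsilon \<Omega> c p a * raise g c p (Upsilon \<Omega> c p) a)"

text \<open>\<open>P g\<close> is the tensor assigned to the metric \<open>g\<close>; only its values for \<open>g \<in> C\<close> matter.\<close>

locale moebius_surface = oriented_surface A
  for A :: "'m::{t2_space,second_countable_topology} chart set" +
  fixes C :: "'m metric set" and P :: "'m metric \<Rightarrow> 'm bilinear_field"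
  assumes conformal: "conformal_class A C"
    and P_tensor: "g \<in> C \<Longrightarrow> symmetric_tensor A (P g)"
    and P_trace: "g \<in> C \<Longrightarrow> c \<in> A \<Longrightarrow> p \<in> fst c \<Longrightarrow>
      trace_wrt g c p (\<lambda>a b. P g c p $ a $ b) = gauss_curvature g c p"
    and P_rescale: "g \<in> C \<Longrightarrow> conformal_factor A \<Omega> \<Longrightarrow> c \<in> A \<Longrightarrow> p \<in> fst c \<Longrightarrow>
      P (rescale \<Omega> g) c p $ a $ b = P g c p $ a $ b
        - nabla1 g c (Upsilon \<Omega> c) p a b + Upsilon \<Omega> c p a * Upsilon \<Omega> c p b
        - (1/2) * g c p $ a $ b * Upsilon_sq g \<Omega> c p"


section \<open>Densities, the conformal Einstein equation and tractors\<close>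

text \<open>A density of weight \<open>1\<close> is represented by one function for every metric of the conformal
  class, and is \<open>0\<close> by convention on bilinear fields outside the class, so that equality of
  densities is equality of the representing maps.\<close>

type_synonym 'm density = "'m metric \<Rightarrow> 'm \<Rightarrow> real"

definition weight1_density :: "'m chart set \<Rightarrow> 'm metric set \<Rightarrow> 'm density \<Rightarrow> bool" where
  "weight1_density A C \<sigma> \<longleftrightarrow>
     (\<forall>g\<in>C. smooth_fun A (\<sigma> g)) \<and>
     (\<forall>g\<in>C. \<forall>\<Omega>. conformal_factor A \<Omega> \<longrightarrow> (\<forall>p. \<sigma> (rescale \<Omega> g) p = \<Omega> p * \<sigma> g p)) \<and>
     (\<forall>g. g \<notin> C \<longrightarrow> \<sigma> g = (\<lambda>p. 0))"

definition nowhere_vanishing :: "'m metric set \<Rightarrow> 'm density \<Rightarrow> bool" where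
  "nowhere_vanishing C \<sigma> \<longleftrightarrow> (\<forall>g\<in>C. \<forall>p. \<sigma> g p \<noteq> 0)"

definition conformal_einstein ::
  "'m chart set \<Rightarrow> 'm metric set \<Rightarrow> ('m metric \<Rightarrow> 'm bilinear_field) \<Rightarrow> 'm density \<Rightarrow> bool" where
  "conformal_einstein A C P \<sigma> \<longleftrightarrow>
     (\<forall>g\<in>C. \<forall>c\<in>A. \<forall>p\<in>fst c. \<forall>a b.
        trace_free g c p
          (\<lambda>a b. nabla1 g c (\<lambda>q d. pd c d (\<sigma> g) q) p a b + P g c p $ a $ b * \<sigma> g p) a b = 0)"

text \<open>A section of the standard tractor bundle is represented by a triple \<open>(\<sigma>, \<mu>, \<Lambda>)\<close> for every
  metric of the class. The slots have weights \<open>1\<close>, \<open>1\<close>, \<open>-1\<close>; as the transformation law of the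
  triple relates weighted quantities, passing to the functions that represent them in the scale
  \<open>\<Omega>\<^sup>2g\<close> contributes the additional factors \<open>\<Omega>\<close>, \<open>\<Omega>\<close>, \<open>\<Omega>\<^sup>-\<^sup>1\<close>.\<close>

type_synonym 'm tractor = "'m metric \<Rightarrow> ('m \<Rightarrow> real) \<times> 'm covector_field \<times> ('m \<Rightarrow> real)"

definition slot_sigma :: "'m tractor \<Rightarrow> 'm metric \<Rightarrow> 'm \<Rightarrow> real" where
  "slot_sigma I g = fst (I g)"

definition slot_mu :: "'m tractor \<Rightarrow> 'm metric \<Rightarrow> 'm covector_field" where
  "slot_mu I g = fst (snd (I g))"

definition slot_Lambda :: "'m tractor \<Rightarrow> 'm metric \<Rightarrow> 'm \<Rightarrow> real" where
  "slot_Lambda I g = snd (snd (I g))"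

definition tractor_section :: "'m chart set \<Rightarrow> 'm metric set \<Rightarrow> 'm tractor \<Rightarrow> bool" where
  "tractor_section A C I \<longleftrightarrow>
     (\<forall>g\<in>C. smooth_fun A (slot_sigma I g) \<and> one_form A (slot_mu I g) \<and>
        smooth_fun A (slot_Lambda I g)) \<and>
     (\<forall>g\<in>C. \<forall>\<Omega>. conformal_factor A \<Omega> \<longrightarrow> (\<forall>c\<in>A. \<forall>p\<in>fst c.
        slot_sigma I (rescale \<Omega> g) p = \<Omega> p * slot_sigma I g p \<and>
        (\<forall>a. slot_mu I (rescale \<Omega> g) c p $ a =
           \<Omega> p * (slot_mu I g c p $ a + Upsilon \<Omega> c p a * slot_sigma I g p)) \<and>
        slot_Lambda I (rescale \<Omega> g) p = inverse (\<Omega> p) *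
          (slot_Lambda I g p
           - (\<Sum>b\<in>UNIV. raise g c p (Upsilon \<Omega> c p) b * slot_mu I g c p $ b)
           - (1/2) * Upsilon_sq g \<Omega> c p * slot_sigma I g p))) \<and>
     (\<forall>g. g \<notin> C \<longrightarrow> I g = (\<lambda>p. 0, \<lambda>c p. 0, \<lambda>p. 0))"

text \<open>The contraction \<open>X\<^sup>AI\<^sub>A\<close>.\<close>

definition tractor_scale :: "'m tractor \<Rightarrow> 'm density" where
  "tractor_scale I = (\<lambda>g. slot_sigma I g)"

definition cotton :: "'m metric \<Rightarrow> ('m metric \<Rightarrow> 'm bilinear_field) \<Rightarrow> 'm chart \<Rightarrow> 'm \<Rightarrow>
    2 \<Rightarrow> 2 \<Rightarrow> 2 \<Rightarrow> real" where
  "cotton g P c p a b d =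
     nabla2 g c (\<lambda>q i j. P g c q $ i $ j) p a b d - nabla2 g c (\<lambda>q i j. P g c q $ i $ j) p b a d"

definition cotton_Y :: "'m metric \<Rightarrow> ('m metric \<Rightarrow> 'm bilinear_field) \<Rightarrow> 'm chart \<Rightarrow> 'm \<Rightarrow>
    2 \<Rightarrow> real" where
  "cotton_Y g P c p d = (\<Sum>a\<in>UNIV. \<Sum>b\<in>UNIV. vol_form_up g c p a b * cotton g P c p a b d)"

definition cotton_U :: "'m metric \<Rightarrow> ('m metric \<Rightarrow> 'm bilinear_field) \<Rightarrow> 'm chart \<Rightarrow> 'm \<Rightarrow>
    2 \<Rightarrow> real" where
  "cotton_U g P c p a = (\<Sum>d\<in>UNIV. vol_form g c p a d * raise g c p (cotton_Y g P c p) d)"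

text \<open>The three slots of \<open>D\<^sub>aI\<close> in the scale \<open>g\<close>. In that scale the Levi-Civita connection acts on
  weighted quantities as on the functions and forms that represent them.\<close>

definition D_sigma :: "'m metric \<Rightarrow> 'm tractor \<Rightarrow> 'm chart \<Rightarrow> 'm \<Rightarrow> 2 \<Rightarrow> real" where
  "D_sigma g I c p a = pd c a (slot_sigma I g) p - slot_mu I g c p $ a"

definition D_mu :: "'m metric \<Rightarrow> ('m metric \<Rightarrow> 'm bilinear_field) \<Rightarrow> 'm tractor \<Rightarrow> 'm chart \<Rightarrow> 'm \<Rightarrow>
    2 \<Rightarrow> 2 \<Rightarrow> real" where
  "D_mu g P I c p a b = nabla1 g c (\<lambda>q d. slot_mu I g c q $ d) p a b
     + P g c p $ a $ b * slot_sigma I g p + slot_Lambda I g p * g c p $ a $ b"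

definition D_Lambda :: "'m metric \<Rightarrow> ('m metric \<Rightarrow> 'm bilinear_field) \<Rightarrow> 'm tractor \<Rightarrow> 'm chart \<Rightarrow>
    'm \<Rightarrow> 2 \<Rightarrow> real" where
  "D_Lambda g P I c p a = pd c a (slot_Lambda I g) p
     - (\<Sum>d\<in>UNIV. P g c p $ a $ d * raise g c p (\<lambda>e. slot_mu I g c p $ e) d)
     + (1/2) * cotton_U g P c p a * slot_sigma I g p"

definition parallel ::
  "'m chart set \<Rightarrow> 'm metric set \<Rightarrow> ('m metric \<Rightarrow> 'm bilinear_field) \<Rightarrow> 'm tractor \<Rightarrow> bool" where
  "parallel A C P I \<longleftrightarrow>
     (\<forall>g\<in>C. \<forall>c\<in>A. \<forall>p\<in>fst c. \<forall>a.
        D_sigma g I c p a = 0 \<and> (\<forall>b. D_mu g P I c p a b = 0) \<and> D_Lambda g P I c p a = 0)"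

end

theory Submission
  imports Defs
begin

text \<open>
  The equation \<open>D I = 0\<close> reads off the whole section from its scale. Its first slot says that
  \<open>\<mu> = d\<sigma>\<close>; the trace of its second slot gives \<open>\<Lambda> = - (1/2) g\<^sup>a\<^sup>b (\<nabla>\<^sub>a\<nabla>\<^sub>b\<sigma> + P\<^sub>a\<^sub>b\<sigma>)\<close>, and the
  trace-free part of the second slot is the conformal Einstein equation. So the map that sends a
  parallel section to its scale is injective with values in the solutions, and its inverse can only
  be the map \<open>scale_tractor\<close>, which fills in these \<open>\<mu>\<close> and \<open>\<Lambda>\<close>. For a solution \<open>\<sigma>\<close> two things have
  to be shown: that this triple is a section of the tractor bundle, and that the third slot of
  \<open>D I = 0\<close> holds as well.

  For the first, \<open>\<Lambda>\<close> must be a function on the surface and obey the tractor transformation law.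
  As \<open>\<sigma>\<close> has no zeros, the metric \<open>g' = \<sigma>\<^sup>-\<^sup>2g\<close> belongs to the class and is the same for every
  representative \<open>g\<close>. The transformation law of \<open>P\<close> from \<open>g\<close> to \<open>g'\<close> (\<open>hessian_P_unit_scale\<close>) says
  \<open>\<nabla>\<^sub>a\<nabla>\<^sub>b\<sigma> + P\<^sub>a\<^sub>b\<sigma> = \<sigma> P'\<^sub>a\<^sub>b + (\<bar>d\<sigma>\<bar>\<^sup>2 / 2\<sigma>) g\<^sub>a\<^sub>b\<close>. Hence \<open>\<Lambda> = - (K' + \<bar>d\<sigma>\<bar>\<^sup>2) / 2\<sigma>\<close> with \<open>K'\<close>
  the trace of \<open>P'\<close> with respect to \<open>g'\<close>. In this formula only traces of tensors and first
  derivatives of \<open>\<sigma>\<close> occur, so both claims follow from the chain rule and the invariance of traces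
  (\<open>bottom_slot_eq\<close>, \<open>bottom_slot_rescale\<close>).

  For the second, apply \<open>\<nabla>\<^sub>c\<close> to the second slot, antisymmetrise in \<open>c\<close> and \<open>a\<close>, and contract with
  \<open>g\<^sup>a\<^sup>b\<close> (\<open>hessian_integrability\<close>, \<open>D_Lambda_vanishes\<close>). The commutator of covariant derivatives
  gives \<open>- K \<nabla>\<^sub>c\<sigma>\<close>, which cancels against the trace of \<open>P\<close>, and the derivatives of \<open>P\<close> give the Cotton
  tensor, which in dimension two is determined by the one-form \<open>U\<close>. What is left is the third slot.
\<close>


section \<open>Calculus of functions of class C^k\<close>

lemma frechet_derivative_eq:
  "(f has_derivative f') (at x) \<Longrightarrow> frechet_derivative f (at x) = f'"
  using frechet_derivative_at by metis

lemma Ck_on_cong: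
  assumes "open S" "\<And>x. x \<in> S \<Longrightarrow> f x = h x" "Ck_on k S f"
  shows "Ck_on k S h"
  using assms(2,3)
proof (induction k arbitrary: f h)
  case 0
  then show ?case by (metis Ck_on.simps(1) continuous_on_cong)
next
  case (Suc k)
  have d: "(h has_derivative frechet_derivative f (at x)) (at x)" if "x \<in> S" for x
    using Suc.prems that \<open>open S\<close>
    by (metis Ck_on.simps(2) frechet_derivative_works has_derivative_transform_within_open)
  then have "frechet_derivative f (at x) v = frechet_derivative h (at x) v" if "x \<in> S" for x v
    using frechet_derivative_eq that by metis
  then have "Ck_on k S (\<lambda>x. frechet_derivative h (at x) v)" for v
    using Suc.IH[of "\<lambda>x. frechet_derivative f (at x) v"] Suc.prems(2) by simp
  with d show ?case by (auto simp: differentiable_def)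
qed

lemma Ck_on_SucI:
  assumes "open S" "\<And>x. x \<in> S \<Longrightarrow> (f has_derivative f' x) (at x)"
    and "\<And>v. Ck_on k S (\<lambda>x. f' x v)"
  shows "Ck_on (Suc k) S f"
proof -
  have "Ck_on k S (\<lambda>x. frechet_derivative f (at x) v)" for v
    by (rule Ck_on_cong[OF assms(1) _ assms(3)[of v]]) (simp add: frechet_derivative_eq[OF assms(2)])
  then show ?thesis using assms(2) by (auto simp: differentiable_def)
qed

lemma Ck_on_SucD: "Ck_on (Suc k) S f \<Longrightarrow> Ck_on k S f"
proof (induction k arbitrary: f)
  case 0
  then show ?case
    by (auto intro!: continuous_at_imp_continuous_on differentiable_imp_continuous_within)
qed auto

lemma Ck_on_has_derivative:
  "Ck_on (Suc k) S f \<Longrightarrow> x \<in> S \<Longrightarrow> (f has_derivative frechet_derivative f (at x)) (at x)"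
  using frechet_derivative_works by auto

lemma Ck_on_const: "Ck_on k S (\<lambda>x. a)"
  by (induction k arbitrary: a) auto

lemma Ck_on_add:
  assumes "open S" "Ck_on k S f" "Ck_on k S h"
  shows "Ck_on k S (\<lambda>x. f x + h x)"
  using assms(2,3)
proof (induction k arbitrary: f h)
  case (Suc k)
  show ?case
    by (rule Ck_on_SucI[OF assms(1) has_derivative_add[OF Ck_on_has_derivative[OF Suc.prems(1)]
          Ck_on_has_derivative[OF Suc.prems(2)]]]) (use Suc in auto)
qed (auto intro: continuous_on_add)

lemma Ck_on_mult:
  fixes f h :: "'a::real_normed_vector \<Rightarrow> real"
  assumes "open S" "Ck_on k S f" "Ck_on k S h"
  shows "Ck_on k S (\<lambda>x. f x * h x)"
  using assms(2,3)
proof (induction k arbitrary: f h)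
  case (Suc k)
  show ?case
  proof (rule Ck_on_SucI[OF assms(1) has_derivative_mult[OF Ck_on_has_derivative[OF Suc.prems(1)]
          Ck_on_has_derivative[OF Suc.prems(2)]]])
    show "Ck_on k S (\<lambda>x. f x * frechet_derivative h (at x) v + frechet_derivative f (at x) v * h x)" for v
      using Suc.prems Ck_on_SucD[OF Suc.prems(1)] Ck_on_SucD[OF Suc.prems(2)]
      by (intro Ck_on_add[OF assms(1)] Suc.IH) auto
  qed
qed (auto intro: continuous_on_mult)

lemma Ck_on_inverse:
  fixes f :: "'a::real_normed_vector \<Rightarrow> real"
  assumes "open S" "\<And>x. x \<in> S \<Longrightarrow> f x \<noteq> 0" "Ck_on k S f"
  shows "Ck_on k S (\<lambda>x. inverse (f x))"
  using assms(3)
proof (induction k)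
  case 0
  then show ?case using assms(2) by (auto intro: continuous_on_inverse)
next
  case (Suc k)
  have i: "Ck_on k S (\<lambda>x. inverse (f x))"
    using Suc.IH Suc.prems Ck_on_SucD by blast
  show ?case
  proof (rule Ck_on_SucI[OF assms(1) Deriv.has_derivative_inverse[OF assms(2) Ck_on_has_derivative[OF Suc.prems]]])
    fix v
    have "Ck_on k S (\<lambda>x. (-1) * (inverse (f x) * frechet_derivative f (at x) v * inverse (f x)))"
      using Suc.prems i by (intro Ck_on_mult[OF assms(1)] Ck_on_const) auto
    then show "Ck_on k S (\<lambda>x. - (inverse (f x) * frechet_derivative f (at x) v * inverse (f x)))"
      by simp
  qed auto
qed

text \<open>A continuous function without zeros has locally constant sign. This makes
  \<open>\<bar>f\<bar> = sgn f * f\<close> as smooth as \<open>f\<close> even when the domain is disconnected and the sign differs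
  between components.\<close>

lemma Ck_on_sgn:
  fixes f :: "'a::real_normed_vector \<Rightarrow> real"
  assumes "open S" "\<And>x. x \<in> S \<Longrightarrow> f x \<noteq> 0" "continuous_on S f"
  shows "Ck_on k S (\<lambda>x. sgn (f x))"
proof -
  have "((\<lambda>x. sgn (f x)) has_derivative (\<lambda>_. 0)) (at x)" if x: "x \<in> S" for x
  proof (rule has_derivative_transform_within_open)
    show "((\<lambda>_. sgn (f x)) has_derivative (\<lambda>_. 0)) (at x)" by simp
    show "open (f -` {y. y * f x > 0} \<inter> S)"
    proof -
      have "open {y. 0 < y * f x}" by (intro open_Collect_less continuous_intros)
      then show ?thesis
        using continuous_open_preimage[OF assms(3,1), of "{y. 0 < y * f x}"]
        by (metis Int_commute)
    qed
    show "x \<in> f -` {y. y * f x > 0} \<inter> S"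
      using x assms(2)[OF x] by (auto simp: zero_less_mult_iff)
  qed (auto simp: zero_less_mult_iff)
  then have "Ck_on (Suc k) S (\<lambda>x. sgn (f x))"
    by (rule Ck_on_SucI[OF assms(1)]) (auto intro: Ck_on_const)
  then show ?thesis by (rule Ck_on_SucD)
qed

text \<open>The second difference of \<open>f\<close> over a small parallelogram is symmetric in the two edges, while the
  mean value theorem, applied once along each edge, turns it into a mixed second derivative at an
  interior point.\<close>

lemma C2_mixed_difference:
  fixes f :: "'a::real_normed_vector \<Rightarrow> real"
  assumes C: "Ck_on 2 S f" and h: "0 < h"
    and seg: "\<And>s t. \<lbrakk>0 \<le> s; s \<le> h; 0 \<le> t; t \<le> h\<rbrakk> \<Longrightarrow> x + s *\<^sub>R v + t *\<^sub>R w \<in> S"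
  obtains s t where "0 < s" "s < h" "0 < t" "t < h"
    "f (x + h *\<^sub>R v + h *\<^sub>R w) - f (x + h *\<^sub>R v) - f (x + h *\<^sub>R w) + f x = h * h *
      frechet_derivative (\<lambda>y. frechet_derivative f (at y) v) (at (x + s *\<^sub>R v + t *\<^sub>R w)) w"
proof -
  define D where "D = (\<lambda>y. frechet_derivative f (at y) v)"
  have C1: "Ck_on (Suc (Suc 0)) S f" using C by (simp add: numeral_2_eq_2)
  then have C2: "Ck_on (Suc 0) S D" unfolding D_def by auto
  have df: "((\<lambda>r. f (a + r *\<^sub>R v)) has_real_derivative D (a + r *\<^sub>R v)) (at r)"
    if "a + r *\<^sub>R v \<in> S" for a r
  proof -
    note d = Ck_on_has_derivative[OF C1 that]
    have "((\<lambda>r. a + r *\<^sub>R v) has_derivative (\<lambda>u. u *\<^sub>R v)) (at r)"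
      by (auto intro!: derivative_eq_intros)
    from has_derivative_compose[OF this d]
    have "((\<lambda>r. f (a + r *\<^sub>R v)) has_derivative (\<lambda>u. frechet_derivative f (at (a + r *\<^sub>R v)) (u *\<^sub>R v))) (at r)" .
    moreover have "frechet_derivative f (at (a + r *\<^sub>R v)) (u *\<^sub>R v) = D (a + r *\<^sub>R v) * u" for u
      using linear_scale[OF has_derivative_linear[OF d]] by (simp add: D_def)
    ultimately show ?thesis by (simp add: has_field_derivative_def)
  qed
  have dD: "((\<lambda>r. D (a + r *\<^sub>R w)) has_real_derivative frechet_derivative D (at (a + r *\<^sub>R w)) w) (at r)"
    if "a + r *\<^sub>R w \<in> S" for a r
  proof -
    note d = Ck_on_has_derivative[OF C2 that]
    have "((\<lambda>r. a + r *\<^sub>R w) has_derivative (\<lambda>u. u *\<^sub>R w)) (at r)"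
      by (auto intro!: derivative_eq_intros)
    from has_derivative_compose[OF this d]
    have "((\<lambda>r. D (a + r *\<^sub>R w)) has_derivative (\<lambda>u. frechet_derivative D (at (a + r *\<^sub>R w)) (u *\<^sub>R w))) (at r)" .
    moreover have "frechet_derivative D (at (a + r *\<^sub>R w)) (u *\<^sub>R w) = frechet_derivative D (at (a + r *\<^sub>R w)) w * u" for u
      using linear_scale[OF has_derivative_linear[OF d]] by simp
    ultimately show ?thesis by (simp add: has_field_derivative_def)
  qed
  define \<phi> where "\<phi> = (\<lambda>r. f ((x + h *\<^sub>R w) + r *\<^sub>R v) - f (x + r *\<^sub>R v))"
  have d\<phi>: "(\<phi> has_real_derivative D ((x + h *\<^sub>R w) + r *\<^sub>R v) - D (x + r *\<^sub>R v)) (at r)"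
    if "0 \<le> r" "r \<le> h" for r
    unfolding \<phi>_def using seg[of r h] seg[of r 0] that h
    by (intro DERIV_diff df) (auto simp: algebra_simps)
  obtain s where s: "0 < s" "s < h"
    and sv: "\<phi> h - \<phi> 0 = h * (D ((x + h *\<^sub>R w) + s *\<^sub>R v) - D (x + s *\<^sub>R v))"
    using MVT2[OF h d\<phi>] by auto
  have d\<psi>: "((\<lambda>r. D ((x + s *\<^sub>R v) + r *\<^sub>R w)) has_real_derivative
      frechet_derivative D (at ((x + s *\<^sub>R v) + r *\<^sub>R w)) w) (at r)" if "0 \<le> r" "r \<le> h" for r
    using seg[of s r] that s by (intro dD) auto
  obtain t where t: "0 < t" "t < h"
    and tv: "D ((x + s *\<^sub>R v) + h *\<^sub>R w) - D ((x + s *\<^sub>R v) + 0 *\<^sub>R w) = h * frechet_derivative D (at ((x + s *\<^sub>R v) + t *\<^sub>R w)) w"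
    using MVT2[OF h d\<psi>] by auto
  show ?thesis
  proof (rule that[OF s t])
    have "f (x + h *\<^sub>R v + h *\<^sub>R w) - f (x + h *\<^sub>R v) - f (x + h *\<^sub>R w) + f x = \<phi> h - \<phi> 0"
      by (simp add: \<phi>_def add_ac)
    also have "\<dots> = h * (h * frechet_derivative D (at ((x + s *\<^sub>R v) + t *\<^sub>R w)) w)"
      using sv tv by (simp add: add_ac)
    finally show "f (x + h *\<^sub>R v + h *\<^sub>R w) - f (x + h *\<^sub>R v) - f (x + h *\<^sub>R w) + f x = h * h *
      frechet_derivative (\<lambda>y. frechet_derivative f (at y) v) (at (x + s *\<^sub>R v + t *\<^sub>R w)) w"
      by (simp add: D_def)
  qed
qed

text \<open>By the preceding lemma, used for both orders of the edges, the two mixed derivatives agree at some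
  pair of points in every small parallelogram at \<open>x\<close>. Continuity moves both points to \<open>x\<close>.\<close>

lemma C2_mixed_derivatives_commute:
  fixes f :: "'a::real_normed_vector \<Rightarrow> real"
  assumes S: "open S" and C: "Ck_on 2 S f" and x: "x \<in> S"
  shows "frechet_derivative (\<lambda>y. frechet_derivative f (at y) v) (at x) w
       = frechet_derivative (\<lambda>y. frechet_derivative f (at y) w) (at x) v"
proof (rule ccontr)
  define F where "F = (\<lambda>v w x. frechet_derivative (\<lambda>y. frechet_derivative f (at y) v) (at x) w)"
  assume "\<not> ?thesis"
  then have ne: "F v w x \<noteq> F w v x" by (simp add: F_def)
  have cont: "continuous_on S (F v w)" for v w
    using C by (simp add: F_def numeral_2_eq_2)
  define e where "e = \<bar>F v w x - F w v x\<bar> / 2"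
  have e: "e > 0" using ne by (simp add: e_def)
  obtain d1 where d1: "d1 > 0" "\<And>y. y \<in> S \<Longrightarrow> dist y x < d1 \<Longrightarrow> dist (F v w y) (F v w x) < e"
    using cont[of v w] x e unfolding continuous_on_iff by blast
  obtain d2 where d2: "d2 > 0" "\<And>y. y \<in> S \<Longrightarrow> dist y x < d2 \<Longrightarrow> dist (F w v y) (F w v x) < e"
    using cont[of w v] x e unfolding continuous_on_iff by blast
  obtain d3 where d3: "d3 > 0" "ball x d3 \<subseteq> S"
    using S x open_contains_ball by blast
  define d where "d = min d1 (min d2 d3)"
  have d: "d > 0" using d1 d2 d3 by (simp add: d_def)
  \<comment> \<open>With edges \<open>h v\<close> and \<open>h w\<close> of this size the whole parallelogram lies within distance \<open>d\<close> of \<open>x\<close>.\<close>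
  define h where "h = d / (2 * (norm v + norm w + 1))"
  have n: "norm v + norm w + 1 > 0" using norm_ge_zero[of v] norm_ge_zero[of w] by linarith
  have h: "h > 0" using d n by (simp add: h_def)
  have near: "dist (x + s *\<^sub>R v + t *\<^sub>R w) x < d" if "0 \<le> s" "s \<le> h" "0 \<le> t" "t \<le> h" for s t
  proof -
    have "norm (s *\<^sub>R v + t *\<^sub>R w) \<le> s * norm v + t * norm w"
      using norm_triangle_ineq[of "s *\<^sub>R v" "t *\<^sub>R w"] that by simp
    also have "\<dots> \<le> h * norm v + h * norm w"
      using that by (intro add_mono mult_right_mono) auto
    also have "\<dots> \<le> h * (norm v + norm w + 1)" using h by (simp add: algebra_simps)
    also have "\<dots> = d / 2"
    proof -
      have "d / (2 * N) * N = d / 2" if "N > 0" for N :: real using that by simp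
      from this[OF n] show ?thesis unfolding h_def .
    qed
    also have "\<dots> < d" using d by simp
    finally show ?thesis by (simp add: dist_norm add.assoc)
  qed
  then have inS: "x + s *\<^sub>R v + t *\<^sub>R w \<in> S" if "0 \<le> s" "s \<le> h" "0 \<le> t" "t \<le> h" for s t
    using near[OF that] d3(2) by (auto simp: d_def dist_commute mem_ball)
  obtain s t where st: "0 < s" "s < h" "0 < t" "t < h" and
    1: "f (x + h *\<^sub>R v + h *\<^sub>R w) - f (x + h *\<^sub>R v) - f (x + h *\<^sub>R w) + f x = h * h * F v w (x + s *\<^sub>R v + t *\<^sub>R w)"
    using C2_mixed_difference[OF C h, of x v w, OF inS] unfolding F_def by auto
  have inS': "x + s *\<^sub>R w + t *\<^sub>R v \<in> S" if "0 \<le> s" "s \<le> h" "0 \<le> t" "t \<le> h" for s t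
    using inS[of t s] that by (simp add: add_ac)
  obtain t' s' where st': "0 < t'" "t' < h" "0 < s'" "s' < h" and
    2: "f (x + h *\<^sub>R w + h *\<^sub>R v) - f (x + h *\<^sub>R w) - f (x + h *\<^sub>R v) + f x = h * h * F w v (x + t' *\<^sub>R w + s' *\<^sub>R v)"
    using C2_mixed_difference[OF C h, of x w v, OF inS'] unfolding F_def by auto
  have "h * h * F v w (x + s *\<^sub>R v + t *\<^sub>R w) = h * h * F w v (x + s' *\<^sub>R v + t' *\<^sub>R w)"
  proof -
    have c: "x + a *\<^sub>R w + b *\<^sub>R v = x + b *\<^sub>R v + a *\<^sub>R w" for a b by simp
    show ?thesis using 1 2[unfolded c] by linarith
  qed
  then have eq: "F v w (x + s *\<^sub>R v + t *\<^sub>R w) = F w v (x + s' *\<^sub>R v + t' *\<^sub>R w)"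
    using h by simp
  have "dist (F v w (x + s *\<^sub>R v + t *\<^sub>R w)) (F v w x) < e"
    using st near[of s t] inS[of s t] d1(2) by (simp add: d_def)
  moreover have "dist (F w v (x + s' *\<^sub>R v + t' *\<^sub>R w)) (F w v x) < e"
    using st' near[of s' t'] inS[of s' t'] d2(2) by (simp add: d_def)
  ultimately show False
    using eq unfolding e_def dist_real_def by argo
qed


section \<open>Partial derivatives in charts\<close>

lemma smooth_on_cong:
  "open S \<Longrightarrow> (\<And>x. x \<in> S \<Longrightarrow> f x = h x) \<Longrightarrow> smooth_on S f \<Longrightarrow> smooth_on S h"
  unfolding smooth_on_def using Ck_on_cong by blast

context oriented_surface
begin

lemma chart_open: "c \<in> A \<Longrightarrow> open (fst c)"
  and chart_image_open: "c \<in> A \<Longrightarrow> open (snd c ` fst c)"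
  and chart_homeomorphism: "c \<in> A \<Longrightarrow> homeomorphism (fst c) (snd c ` fst c) (snd c) (chart_inv c)"
  using charts by blast+

lemma chart_inv_left: "c \<in> A \<Longrightarrow> p \<in> fst c \<Longrightarrow> chart_inv c (snd c p) = p"
  using chart_homeomorphism homeomorphism_apply1 by blast

lemma chart_inv_right: "c \<in> A \<Longrightarrow> y \<in> snd c ` fst c \<Longrightarrow> snd c (chart_inv c y) = y"
  by (metis chart_inv_left imageE)

lemma chart_inv_in: "c \<in> A \<Longrightarrow> y \<in> snd c ` fst c \<Longrightarrow> chart_inv c y \<in> fst c"
  by (metis chart_inv_left imageE)

lemma overlap_image_open: "c \<in> A \<Longrightarrow> d \<in> A \<Longrightarrow> open (snd c ` (fst c \<inter> fst d))"
  by (metis chart_homeomorphism chart_image_open chart_open homeomorphism_imp_open_map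
      inf_le1 open_Int open_openin openin_open_eq openin_open_trans)

lemma chart_at: obtains c where "c \<in> A" "p \<in> fst c"
  using covering by blast

lemma smooth_in_chart_cong:
  assumes "c \<in> A" "\<And>q. q \<in> fst c \<Longrightarrow> f q = h q" "smooth_in_chart c f"
  shows "smooth_in_chart c h"
  using assms(3) unfolding smooth_in_chart_def
  by (rule smooth_on_cong[OF chart_image_open[OF assms(1)], rotated])
    (use assms(2) chart_inv_in[OF assms(1)] in auto)

lemma pd_cong:
  assumes c: "c \<in> A" "p \<in> fst c" and eq: "\<And>q. q \<in> fst c \<Longrightarrow> f q = h q"
  shows "pd c a f p = pd c a h p"
proof -
  have "(f \<circ> chart_inv c has_derivative F) (at (snd c p)) \<longleftrightarrow> (h \<circ> chart_inv c has_derivative F) (at (snd c p))" for F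
    by (rule iffI; erule has_derivative_transform_within_open[OF _ chart_image_open[OF c(1)]])
      (use c eq chart_inv_in[OF c(1)] in auto)
  then show ?thesis by (simp add: pd_def frechet_derivative_def)
qed

lemma smooth_in_chart_const: "c \<in> A \<Longrightarrow> smooth_in_chart c (\<lambda>q. k)"
  by (simp add: smooth_in_chart_def smooth_on_def o_def Ck_on_const)

lemma smooth_in_chart_add:
  "c \<in> A \<Longrightarrow> smooth_in_chart c f \<Longrightarrow> smooth_in_chart c h \<Longrightarrow> smooth_in_chart c (\<lambda>q. f q + h q)"
  by (simp add: smooth_in_chart_def smooth_on_def o_def Ck_on_add chart_image_open)

lemma smooth_in_chart_mult:
  "c \<in> A \<Longrightarrow> smooth_in_chart c f \<Longrightarrow> smooth_in_chart c h \<Longrightarrow> smooth_in_chart c (\<lambda>q. f q * h q)"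
  by (simp add: smooth_in_chart_def smooth_on_def o_def Ck_on_mult chart_image_open)

lemma smooth_in_chart_minus:
  "c \<in> A \<Longrightarrow> smooth_in_chart c f \<Longrightarrow> smooth_in_chart c (\<lambda>q. - f q)"
  using smooth_in_chart_mult[OF _ smooth_in_chart_const[of c "-1"]] by simp

lemma smooth_in_chart_diff:
  "c \<in> A \<Longrightarrow> smooth_in_chart c f \<Longrightarrow> smooth_in_chart c h \<Longrightarrow> smooth_in_chart c (\<lambda>q. f q - h q)"
  using smooth_in_chart_add[OF _ _ smooth_in_chart_minus] by simp

lemma smooth_in_chart_inverse:
  "c \<in> A \<Longrightarrow> (\<And>q. q \<in> fst c \<Longrightarrow> f q \<noteq> 0) \<Longrightarrow> smooth_in_chart c f \<Longrightarrow> smooth_in_chart c (\<lambda>q. inverse (f q))"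
  by (simp add: smooth_in_chart_def smooth_on_def o_def Ck_on_inverse chart_image_open chart_inv_in)

lemma smooth_in_chart_divide:
  "c \<in> A \<Longrightarrow> (\<And>q. q \<in> fst c \<Longrightarrow> h q \<noteq> 0) \<Longrightarrow> smooth_in_chart c f \<Longrightarrow> smooth_in_chart c h
    \<Longrightarrow> smooth_in_chart c (\<lambda>q. f q / h q)"
  unfolding divide_inverse by (intro smooth_in_chart_mult smooth_in_chart_inverse)

lemma smooth_in_chart_sgn:
  assumes "c \<in> A" "\<And>q. q \<in> fst c \<Longrightarrow> f q \<noteq> 0" "smooth_in_chart c f"
  shows "smooth_in_chart c (\<lambda>q. sgn (f q))"
proof -
  have "continuous_on (snd c ` fst c) (f \<circ> chart_inv c)"
    using assms(3) unfolding smooth_in_chart_def smooth_on_def by (metis Ck_on.simps(1))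
  then show ?thesis
    unfolding smooth_in_chart_def smooth_on_def
    using assms(2)[OF chart_inv_in[OF assms(1)]] Ck_on_sgn[OF chart_image_open[OF assms(1)]]
    by (simp add: o_def)
qed

lemma smooth_in_chart_sum:
  "c \<in> A \<Longrightarrow> (\<And>i. i \<in> I \<Longrightarrow> smooth_in_chart c (f i)) \<Longrightarrow> smooth_in_chart c (\<lambda>q. \<Sum>i\<in>I. f i q)"
  by (induction I rule: infinite_finite_induct) (auto intro: smooth_in_chart_add smooth_in_chart_const)

lemmas smooth_intros = smooth_in_chart_const smooth_in_chart_add smooth_in_chart_mult
  smooth_in_chart_minus smooth_in_chart_diff smooth_in_chart_divide smooth_in_chart_sum

lemma smooth_in_chart_has_derivative:
  assumes "c \<in> A" "p \<in> fst c" "smooth_in_chart c f"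
  shows "(f \<circ> chart_inv c has_derivative frechet_derivative (f \<circ> chart_inv c) (at (snd c p))) (at (snd c p))"
  using assms unfolding smooth_in_chart_def smooth_on_def by (blast intro: Ck_on_has_derivative)

lemma pd_comp_chart_inv:
  assumes "c \<in> A" "y \<in> snd c ` fst c"
  shows "(pd c a f \<circ> chart_inv c) y = frechet_derivative (f \<circ> chart_inv c) (at y) (axis a 1)"
  using chart_inv_right[OF assms] by (simp add: pd_def)

lemma smooth_in_chart_pd:
  assumes "c \<in> A" "smooth_in_chart c f"
  shows "smooth_in_chart c (pd c a f)"
proof -
  have "smooth_on (snd c ` fst c) (\<lambda>y. frechet_derivative (f \<circ> chart_inv c) (at y) (axis a 1))"
    using assms(2) unfolding smooth_in_chart_def smooth_on_def by (metis Ck_on.simps(2))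
  then show ?thesis unfolding smooth_in_chart_def
    by (rule smooth_on_cong[OF chart_image_open[OF assms(1)], rotated])
      (simp add: pd_comp_chart_inv[OF assms(1)] del: o_apply)
qed

text \<open>The composite of \<open>pd c a f\<close> with the inverse chart is a derivative of the coordinate expression
  only on the chart image, so the symmetry of second derivatives is carried over from that open set.\<close>

lemma pd_commute:
  assumes c: "c \<in> A" "p \<in> fst c" and f: "smooth_in_chart c f"
  shows "pd c a (pd c b f) p = pd c b (pd c a f) p"
proof -
  let ?F = "f \<circ> chart_inv c" and ?S = "snd c ` fst c" and ?x = "snd c p"
  have x: "?x \<in> ?S" using c by blast
  have pd2: "pd c a (pd c b f) p
      = frechet_derivative (\<lambda>y. frechet_derivative ?F (at y) (axis b 1)) (at ?x) (axis a 1)" for a b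
  proof -
    have "(pd c b f \<circ> chart_inv c has_derivative D) (at ?x)
      \<longleftrightarrow> ((\<lambda>y. frechet_derivative ?F (at y) (axis b 1)) has_derivative D) (at ?x)" for D
      by (rule iffI; erule has_derivative_transform_within_open[OF _ chart_image_open[OF c(1)] x])
        (simp_all add: pd_comp_chart_inv[OF c(1)] del: o_apply)
    then show ?thesis by (simp add: pd_def[of c a] frechet_derivative_def[of _ "at ?x"])
  qed
  show ?thesis unfolding pd2
    using f c by (intro C2_mixed_derivatives_commute[OF chart_image_open[OF c(1)] _ x])
      (simp add: smooth_in_chart_def smooth_on_def)
qed

lemma pd_eqI:
  assumes "(f \<circ> chart_inv c has_derivative D) (at (snd c p))"
  shows "pd c a f p = D (axis a 1)"
  using frechet_derivative_eq[OF assms] by (simp add: pd_def)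

lemma pd_const [simp]: "pd c a (\<lambda>q. k) p = 0"
  by (simp add: pd_def o_def)

context
  fixes c p f h
  assumes c: "c \<in> A" "p \<in> fst c" and f: "smooth_in_chart c f" and h: "smooth_in_chart c h"
begin

lemma pd_add: "pd c a (\<lambda>q. f q + h q) p = pd c a f p + pd c a h p"
  using pd_eqI[of "\<lambda>q. f q + h q", unfolded o_def, OF has_derivative_add[OF
      smooth_in_chart_has_derivative[OF c f, unfolded o_def] smooth_in_chart_has_derivative[OF c h, unfolded o_def]]]
  by (simp add: pd_def o_def)

lemma pd_diff: "pd c a (\<lambda>q. f q - h q) p = pd c a f p - pd c a h p"
  using pd_eqI[of "\<lambda>q. f q - h q", unfolded o_def, OF has_derivative_diff[OF
      smooth_in_chart_has_derivative[OF c f, unfolded o_def] smooth_in_chart_has_derivative[OF c h, unfolded o_def]]]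
  by (simp add: pd_def o_def)

lemma pd_mult: "pd c a (\<lambda>q. f q * h q) p = pd c a f p * h p + f p * pd c a h p"
  using pd_eqI[of "\<lambda>q. f q * h q", unfolded o_def, OF has_derivative_mult[OF
      smooth_in_chart_has_derivative[OF c f, unfolded o_def] smooth_in_chart_has_derivative[OF c h, unfolded o_def]], of a]
    chart_inv_left[OF c]
  by (simp add: pd_def o_def)

end

lemma pd_ln:
  assumes "c \<in> A" "p \<in> fst c" "smooth_in_chart c f" "f p > 0"
  shows "pd c a (\<lambda>q. ln (f q)) p = pd c a f p / f p"
proof -
  have "((\<lambda>y. ln ((f \<circ> chart_inv c) y)) has_derivative
      (\<lambda>v. frechet_derivative (f \<circ> chart_inv c) (at (snd c p)) v * inverse (f p))) (at (snd c p))"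
    using has_derivative_ln[OF _ smooth_in_chart_has_derivative[OF assms(1-3)]] assms
    by (simp add: chart_inv_left)
  from pd_eqI[of "\<lambda>q. ln (f q)", unfolded o_def, OF this[unfolded o_def]]
  show ?thesis by (simp add: pd_def o_def divide_inverse)
qed

lemma pd_transform:
  assumes c: "c \<in> A" "d \<in> A" "p \<in> fst c \<inter> fst d" and f: "smooth_in_chart d f"
  shows "pd c a f p = (\<Sum>i\<in>UNIV. jacobian c d p $ i $ a * pd d i f p)"
proof -
  let ?T = "snd d \<circ> chart_inv c" and ?x = "snd c p" and ?F = "f \<circ> chart_inv d"
  let ?S = "snd c ` (fst c \<inter> fst d)"
  have x: "?x \<in> ?S" using c by auto
  have Tx: "?T ?x = snd d p" using c chart_inv_left by simp
  have dT: "(?T has_derivative frechet_derivative ?T (at ?x)) (at ?x)"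
    using transition_smooth[OF c(1,2)] x unfolding smooth_on_def by (blast intro: Ck_on_has_derivative)
  have dF: "(?F has_derivative frechet_derivative ?F (at (snd d p))) (at (snd d p))"
    using smooth_in_chart_has_derivative[OF c(2) _ f] c by auto
  have "(?F \<circ> ?T has_derivative frechet_derivative ?F (at (snd d p)) \<circ> frechet_derivative ?T (at ?x)) (at ?x)"
    by (rule diff_chain_at[OF dT]) (use dF Tx in simp)
  then have "(f \<circ> chart_inv c has_derivative frechet_derivative ?F (at (snd d p)) \<circ> frechet_derivative ?T (at ?x)) (at ?x)"
    by (rule has_derivative_transform_within_open[OF _ overlap_image_open[OF c(1,2)] x])
      (use c chart_inv_left[OF c(1)] chart_inv_left[OF c(2)] in auto)
  from pd_eqI[OF this] have pd: "pd c a f p = frechet_derivative ?F (at (snd d p)) (frechet_derivative ?T (at ?x) (axis a 1))"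
    by simp
  have lin: "linear (frechet_derivative ?F (at (snd d p)))" using dF has_derivative_linear by blast
  have "frechet_derivative ?T (at ?x) (axis a 1) = (\<Sum>i\<in>UNIV. jacobian c d p $ i $ a *\<^sub>R axis i 1)"
    by (simp add: jacobian_def matrix_def vec_eq_iff axis_def if_distrib[of "\<lambda>x. _ * x"] cong: if_cong)
  then show ?thesis unfolding pd
    by (simp add: linear_sum[OF lin] linear_scale[OF lin] pd_def)
qed

end


section \<open>Levi-Civita connection and curvature of a surface\<close>

lemma ginv_eq:
  assumes "det (g c p) \<noteq> 0"
  shows "ginv g c p 1 1 = g c p $ 2 $ 2 / det (g c p)"
    "ginv g c p 1 2 = - g c p $ 1 $ 2 / det (g c p)"
    "ginv g c p 2 1 = - g c p $ 2 $ 1 / det (g c p)"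
    "ginv g c p 2 2 = g c p $ 1 $ 1 / det (g c p)"
proof -
  define M where "M = g c p"
  define N :: "real^2^2" where "N = (\<chi> i j. (if i = j then M $ (3 - i) $ (3 - j) else - M $ i $ j) / det M)"
  have d: "det M \<noteq> 0" using assms by (simp add: M_def)
  have N: "N$1$1 = M$2$2 / det M" "N$1$2 = - M$1$2 / det M" "N$2$1 = - M$2$1 / det M" "N$2$2 = M$1$1 / det M"
    by (simp_all add: N_def)
  have d2: "M$1$1 * M$2$2 - M$1$2 * M$2$1 \<noteq> 0" using d by (simp add: det_2)
  have MN: "M ** N = mat 1"
    using d2 by (simp add: vec_eq_iff forall_2 matrix_matrix_mult_def sum_2 mat_def N det_2 divide_simps)
  have "invertible M" using d invertible_det_nz by blast
  then have "matrix_inv M ** M = mat 1"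
    unfolding invertible_def matrix_inv_def by (rule someI2_ex) auto
  then have "matrix_inv M = N"
    using MN by (metis matrix_mul_assoc matrix_mul_lid matrix_mul_rid)
  then show "ginv g c p 1 1 = g c p $ 2 $ 2 / det (g c p)"
    "ginv g c p 1 2 = - g c p $ 1 $ 2 / det (g c p)"
    "ginv g c p 2 1 = - g c p $ 2 $ 1 / det (g c p)"
    "ginv g c p 2 2 = g c p $ 1 $ 1 / det (g c p)"
    using N by (simp_all add: ginv_def M_def)
qed

lemma lower_ginv:
  assumes "det (g c p) \<noteq> 0"
  shows "(\<Sum>e\<in>UNIV. g c p $ d $ e * (\<Sum>f\<in>UNIV. ginv g c p e f * X f)) = X d"
proof -
  have "g c p $ 1 $ 1 * g c p $ 2 $ 2 - g c p $ 1 $ 2 * g c p $ 2 $ 1 \<noteq> 0"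
    using assms by (simp add: det_2)
  then show ?thesis
    using exhaust_2[of d] by (auto simp: sum_2 ginv_eq[of g c p, OF assms] det_2 divide_simps) (auto simp: algebra_simps)
qed

lemma ginv_lower:
  assumes "det (g c p) \<noteq> 0"
  shows "(\<Sum>d\<in>UNIV. ginv g c p e d * (\<Sum>f\<in>UNIV. g c p $ d $ f * X f)) = X e"
proof -
  have "g c p $ 1 $ 1 * g c p $ 2 $ 2 - g c p $ 1 $ 2 * g c p $ 2 $ 1 \<noteq> 0"
    using assms by (simp add: det_2)
  then show ?thesis
    using exhaust_2[of e] by (auto simp: sum_2 ginv_eq[of g c p, OF assms] det_2 divide_simps) (auto simp: algebra_simps)
qed

lemma metric_sym: "riemannian_metric A g \<Longrightarrow> c \<in> A \<Longrightarrow> p \<in> fst c \<Longrightarrow> g c p $ a $ b = g c p $ b $ a"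
  unfolding riemannian_metric_def symmetric_tensor_def by blast

lemma metric_smooth: "riemannian_metric A g \<Longrightarrow> c \<in> A \<Longrightarrow> smooth_in_chart c (\<lambda>q. g c q $ a $ b)"
  unfolding riemannian_metric_def symmetric_tensor_def by blast

lemma metric_det_pos:
  assumes "riemannian_metric A g" "c \<in> A" "p \<in> fst c"
  shows "det (g c p) > 0"
proof -
  let ?g = "\<lambda>a b. g c p $ a $ b"
  have pos: "v \<bullet> (g c p *v v) > 0" if "v \<noteq> 0" for v
    using assms that unfolding riemannian_metric_def by blast
  have s: "?g 2 1 = ?g 1 2" by (rule metric_sym[OF assms])
  have 11: "?g 1 1 > 0"
    using pos[of "axis 1 1", unfolded axis_eq_0_iff] by (simp add: inner_vec_def matrix_vector_mult_def sum_2 axis_def)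
  \<comment> \<open>The vector orthogonal to the first coordinate direction; its squared length is \<open>g\<^sub>1\<^sub>1 det g\<close>.\<close>
  define v :: "real^2" where "v = (\<chi> i. if i = 1 then - ?g 1 2 else ?g 1 1)"
  have v: "v $ 1 = - ?g 1 2" "v $ 2 = ?g 1 1" by (simp_all add: v_def)
  then have "v \<noteq> 0" using 11 by (metis less_irrefl zero_index)
  from pos[OF this] have "?g 1 1 * det (g c p) > 0"
    by (simp add: inner_vec_def matrix_vector_mult_def sum_2 v s det_2 algebra_simps)
  with 11 show ?thesis by (simp add: zero_less_mult_iff)
qed

context oriented_surface
begin

context
  fixes g c
  assumes g: "riemannian_metric A g" and c: "c \<in> A"
begin

lemma det_smooth: "smooth_in_chart c (\<lambda>q. det (g c q))"
  unfolding det_2 by (intro smooth_intros metric_smooth[OF g] c)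

lemma metric_det_nonzero: "p \<in> fst c \<Longrightarrow> det (g c p) \<noteq> 0"
  using metric_det_pos[OF g c] by force

lemma ginv_smooth: "smooth_in_chart c (\<lambda>q. ginv g c q a b)"
proof -
  note sm = smooth_in_chart_cong[OF c]
  have "smooth_in_chart c (\<lambda>q. ginv g c q 1 1)"
    by (rule sm[of "\<lambda>q. g c q $ 2 $ 2 / det (g c q)"])
      (auto simp: ginv_eq metric_det_nonzero intro!: smooth_intros c metric_smooth[OF g] det_smooth)
  moreover have "smooth_in_chart c (\<lambda>q. ginv g c q 1 2)"
    by (rule sm[of "\<lambda>q. - g c q $ 1 $ 2 / det (g c q)"])
      (auto simp: ginv_eq metric_det_nonzero intro!: smooth_intros c metric_smooth[OF g] det_smooth)
  moreover have "smooth_in_chart c (\<lambda>q. ginv g c q 2 1)"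
    by (rule sm[of "\<lambda>q. - g c q $ 2 $ 1 / det (g c q)"])
      (auto simp: ginv_eq metric_det_nonzero intro!: smooth_intros c metric_smooth[OF g] det_smooth)
  moreover have "smooth_in_chart c (\<lambda>q. ginv g c q 2 2)"
    by (rule sm[of "\<lambda>q. g c q $ 1 $ 1 / det (g c q)"])
      (auto simp: ginv_eq metric_det_nonzero intro!: smooth_intros c metric_smooth[OF g] det_smooth)
  ultimately show ?thesis using exhaust_2[of a] exhaust_2[of b] by auto
qed

lemma christoffel_smooth: "smooth_in_chart c (\<lambda>q. christoffel g c q e a b)"
  unfolding christoffel_def
  by (intro smooth_intros ginv_smooth smooth_in_chart_pd metric_smooth[OF g] c)

lemma pd_metric_sym: "p \<in> fst c \<Longrightarrow> pd c a (\<lambda>q. g c q $ b $ d) p = pd c a (\<lambda>q. g c q $ d $ b) p"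
  by (rule pd_cong[OF c]) (simp_all add: metric_sym[OF g c])

lemma christoffel_sym: "p \<in> fst c \<Longrightarrow> christoffel g c p e a b = christoffel g c p e b a"
  unfolding christoffel_def by (simp add: pd_metric_sym[of p _ a b] add_ac)

lemma christoffel_lower:
  assumes "p \<in> fst c"
  shows "(\<Sum>e\<in>UNIV. g c p $ d $ e * christoffel g c p e a b) =
    (1/2) * (pd c a (\<lambda>q. g c q $ b $ d) p + pd c b (\<lambda>q. g c q $ a $ d) p - pd c d (\<lambda>q. g c q $ a $ b) p)"
  unfolding christoffel_def
  using lower_ginv[of g c p, OF metric_det_nonzero[OF assms], of d "\<lambda>d. (1/2) *
    (pd c a (\<lambda>q. g c q $ b $ d) p + pd c b (\<lambda>q. g c q $ a $ d) p - pd c d (\<lambda>q. g c q $ a $ b) p)"]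
  by (simp add: sum_distrib_left mult_ac)

text \<open>The metric is parallel for its Levi-Civita connection, \<open>\<nabla>g = 0\<close>, solved for the partial
  derivatives of the metric.\<close>

lemma pd_metric:
  assumes "p \<in> fst c"
  shows "pd c a (\<lambda>q. g c q $ b $ d) p =
    (\<Sum>e\<in>UNIV. g c p $ d $ e * christoffel g c p e a b) + (\<Sum>e\<in>UNIV. g c p $ b $ e * christoffel g c p e a d)"
  unfolding christoffel_lower[OF assms]
  by (simp add: pd_metric_sym[OF assms, of a d b] pd_metric_sym[OF assms, of d a b] pd_metric_sym[OF assms, of b a d] field_simps)

text \<open>Writing the lowered symbols as first derivatives of the metric and differentiating \<open>\<nabla>g = 0\<close> once
  more, the curvature with lowered index becomes a sum of two parts. The second derivatives of the
  metric cancel on symmetrisation because partial derivatives commute. The quadratic part is the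
  inner product of \<open>\<Gamma>\<^sub>2\<^sub>d\<close> with \<open>\<Gamma>\<^sub>1\<^sub>b\<close> minus that of \<open>\<Gamma>\<^sub>1\<^sub>d\<close> with \<open>\<Gamma>\<^sub>2\<^sub>b\<close>, which is
  antisymmetric in \<open>b\<close> and \<open>d\<close> since the metric is symmetric.\<close>

lemma lowered_riemann_antisym:
  assumes p: "p \<in> fst c"
  shows "(\<Sum>e\<in>UNIV. g c p $ d $ e * riemann g c p 1 2 b e) = - (\<Sum>e\<in>UNIV. g c p $ b $ e * riemann g c p 1 2 d e)"
proof -
  note sm = metric_smooth[OF g c] christoffel_smooth c
  let ?G = "\<lambda>e a b. christoffel g c p e a b" and ?g = "\<lambda>a b. g c p $ a $ b"
  let ?dG = "\<lambda>i e a b. pd c i (\<lambda>q. christoffel g c q e a b) p"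
  let ?dg = "\<lambda>i a b. pd c i (\<lambda>q. g c q $ a $ b) p"
  let ?ddg = "\<lambda>i j a b. pd c i (pd c j (\<lambda>q. g c q $ a $ b)) p"
  have d\<Gamma>: "(\<Sum>e\<in>UNIV. ?dg i d e * ?G e a b + ?g d e * ?dG i e a b)
      = (1/2) * (?ddg i a b d + ?ddg i b a d - ?ddg i d a b)" for i d a b
  proof -
    have "pd c i (\<lambda>q. \<Sum>e\<in>UNIV. g c q $ d $ e * christoffel g c q e a b) p
      = pd c i (\<lambda>q. (1/2) * (pd c a (\<lambda>q. g c q $ b $ d) q + pd c b (\<lambda>q. g c q $ a $ d) q - pd c d (\<lambda>q. g c q $ a $ b) q)) p"
      by (rule pd_cong[OF c p christoffel_lower])
    moreover have "pd c i (\<lambda>q. \<Sum>e\<in>UNIV. g c q $ d $ e * christoffel g c q e a b) p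
      = (\<Sum>e\<in>UNIV. ?dg i d e * ?G e a b + ?g d e * ?dG i e a b)"
      unfolding sum_2 by (simp add: pd_add pd_mult c p sm smooth_intros)
    moreover have "pd c i (\<lambda>q. (1/2) * (pd c a (\<lambda>q. g c q $ b $ d) q + pd c b (\<lambda>q. g c q $ a $ d) q - pd c d (\<lambda>q. g c q $ a $ b) q)) p
      = (1/2) * (?ddg i a b d + ?ddg i b a d - ?ddg i d a b)"
      by (subst pd_mult[OF c p], (intro smooth_intros smooth_in_chart_pd sm)+)
        (simp add: pd_add pd_diff c p sm smooth_intros smooth_in_chart_pd)
    ultimately show ?thesis by simp
  qed
  have comm: "?ddg 2 1 a b = ?ddg 1 2 a b" for a b
    by (rule pd_commute[OF c p metric_smooth[OF g c]])
  have dds: "?ddg i j a b = ?ddg i j b a" for i j a b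
    by (rule pd_cong[OF c p]) (rule pd_metric_sym)
  \<comment> \<open>This form eliminates the derivatives of the Christoffel symbols, which occur in the curvature
    contracted with the metric.\<close>
  have gdG: "?g d 1 * ?dG i 1 a b + ?g d 2 * ?dG i 2 a b
      = (1/2) * (?ddg i a b d + ?ddg i b a d - ?ddg i d a b) - (?dg i d 1 * ?G 1 a b + ?dg i d 2 * ?G 2 a b)" for i d a b
    using d\<Gamma>[of i d a b] by (simp add: sum_2 field_simps)
  have g21: "?g 2 1 = ?g 1 2" by (rule metric_sym[OF g c p])
  have R: "(\<Sum>e\<in>UNIV. ?g d e * riemann g c p 1 2 b e)
     = (1/2) * (?ddg 1 2 b d + ?ddg 1 b 2 d - ?ddg 1 d 2 b) - (1/2) * (?ddg 2 1 b d + ?ddg 2 b 1 d - ?ddg 2 d 1 b)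
       + ((?g 1 1 * ?G 1 2 d + ?g 1 2 * ?G 2 2 d) * ?G 1 1 b + (?g 1 2 * ?G 1 2 d + ?g 2 2 * ?G 2 2 d) * ?G 2 1 b)
       - ((?g 1 1 * ?G 1 1 d + ?g 1 2 * ?G 2 1 d) * ?G 1 2 b + (?g 1 2 * ?G 1 1 d + ?g 2 2 * ?G 2 1 d) * ?G 2 2 b)"
    for b d
  proof -
    have "(\<Sum>e\<in>UNIV. ?g d e * riemann g c p 1 2 b e)
      = (?g d 1 * ?dG 1 1 2 b + ?g d 2 * ?dG 1 2 2 b) - (?g d 1 * ?dG 2 1 1 b + ?g d 2 * ?dG 2 2 1 b)
       + ?g d 1 * (?G 1 1 1 * ?G 1 2 b + ?G 1 1 2 * ?G 2 2 b - ?G 1 2 1 * ?G 1 1 b - ?G 1 2 2 * ?G 2 1 b)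
       + ?g d 2 * (?G 2 1 1 * ?G 1 2 b + ?G 2 1 2 * ?G 2 2 b - ?G 2 2 1 * ?G 1 1 b - ?G 2 2 2 * ?G 2 1 b)"
      by (simp add: riemann_def sum_2 algebra_simps)
    also have "\<dots> = (1/2) * (?ddg 1 2 b d + ?ddg 1 b 2 d - ?ddg 1 d 2 b) - (1/2) * (?ddg 2 1 b d + ?ddg 2 b 1 d - ?ddg 2 d 1 b)
       + ((?g 1 1 * ?G 1 2 d + ?g 1 2 * ?G 2 2 d) * ?G 1 1 b + (?g 1 2 * ?G 1 2 d + ?g 2 2 * ?G 2 2 d) * ?G 2 1 b)
       - ((?g 1 1 * ?G 1 1 d + ?g 1 2 * ?G 2 1 d) * ?G 1 2 b + (?g 1 2 * ?G 1 1 d + ?g 2 2 * ?G 2 1 d) * ?G 2 2 b)"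
      unfolding gdG pd_metric[OF p] sum_2 g21 by (simp add: algebra_simps)
    finally show ?thesis .
  qed
  show ?thesis
    unfolding R using exhaust_2[of b] exhaust_2[of d]
    by (elim disjE) (simp_all add: comm dds[of _ _ 2 1] algebra_simps)
qed

text \<open>In dimension two the antisymmetries leave a single independent component, which the Gauss curvature
  names.\<close>

lemma riemann_eq_gauss:
  assumes p: "p \<in> fst c"
  shows "riemann g c p 1 2 b e = gauss_curvature g c p *
    ((if e = 1 then g c p $ 2 $ b else 0) - (if e = 2 then g c p $ 1 $ b else 0))"
proof -
  \<comment> \<open>\<open>L b d\<close> is the curvature component with the upper index lowered to \<open>d\<close>.\<close>
  define L where "L = (\<lambda>b d. \<Sum>e\<in>UNIV. g c p $ d $ e * riemann g c p 1 2 b e)"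
  note nz = metric_det_nonzero[OF p]
  have anti: "L b d = - L d b" for b d unfolding L_def by (rule lowered_riemann_antisym[OF p])
  have L21: "L 2 1 = gauss_curvature g c p * det (g c p)"
    using nz by (simp add: L_def gauss_curvature_def)
  have L: "L 1 1 = 0" "L 2 2 = 0" "L 1 2 = - gauss_curvature g c p * det (g c p)"
    using anti[of 1 1] anti[of 2 2] anti[of 1 2] L21 by auto
  have "riemann g c p 1 2 b e = (\<Sum>d\<in>UNIV. ginv g c p e d * L b d)"
    unfolding L_def using ginv_lower[of g c p, OF nz, of e "\<lambda>e. riemann g c p 1 2 b e"] by simp
  then show ?thesis
    using exhaust_2[of b] exhaust_2[of e] nz metric_sym[OF g c p, of 2 1]
    by (auto simp: sum_2 L L21 ginv_eq)
qed

text \<open>Antisymmetry of the Cotton tensor in its first pair makes the contraction with the volume form twice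
  the component \<open>Y\<^sub>1\<^sub>2\<^sub>e\<close>, and the square roots of the determinant coming from the two volume forms
  cancel.\<close>

lemma cotton_U_eq:
  assumes p: "p \<in> fst c"
  shows "cotton_U g P c p 1 = 2 * (\<Sum>e\<in>UNIV. ginv g c p 2 e * cotton g P c p 1 2 e)"
    "cotton_U g P c p 2 = - 2 * (\<Sum>e\<in>UNIV. ginv g c p 1 e * cotton g P c p 1 2 e)"
proof -
  let ?s = "sqrt (det (g c p))"
  have pos: "det (g c p) > 0" by (rule metric_det_pos[OF g c p])
  have s: "?s \<noteq> 0" "?s * ?s = det (g c p)" using pos by auto
  have "1 / (x * x) * x = 1 / x" if "x \<noteq> 0" for x :: real using that by simp
  from this[OF s(1), unfolded s(2)] have det_s: "?s / det (g c p) = 1 / ?s" by simp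
  have dinv: "ginv g c p 1 1 * ginv g c p 2 2 - ginv g c p 1 2 * ginv g c p 2 1 = 1 / det (g c p)"
  proof -
    have "ginv g c p 1 1 * ginv g c p 2 2 - ginv g c p 1 2 * ginv g c p 2 1
       = (g c p $ 1 $ 1 * g c p $ 2 $ 2 - g c p $ 1 $ 2 * g c p $ 2 $ 1) / (det (g c p) * det (g c p))"
      using pos by (simp add: ginv_eq diff_divide_distrib mult.commute)
    also have "\<dots> = det (g c p) / (det (g c p) * det (g c p))" by (simp add: det_2)
    finally show ?thesis using pos by simp
  qed
  have "vol_form_up g c p 1 2 = (ginv g c p 1 1 * ginv g c p 2 2 - ginv g c p 1 2 * ginv g c p 2 1) * ?s"
    "vol_form_up g c p 2 1 = - (ginv g c p 1 1 * ginv g c p 2 2 - ginv g c p 1 2 * ginv g c p 2 1) * ?s"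
    "vol_form_up g c p 1 1 = 0" "vol_form_up g c p 2 2 = 0"
    by (simp_all add: vol_form_up_def sum_2 vol_form_def algebra_simps)
  then have up: "vol_form_up g c p 1 2 = 1 / ?s" "vol_form_up g c p 2 1 = - 1 / ?s"
    "vol_form_up g c p 1 1 = 0" "vol_form_up g c p 2 2 = 0"
    unfolding dinv using det_s by simp_all
  have "cotton g P c p 2 1 d = - cotton g P c p 1 2 d" for d
    by (simp add: cotton_def)
  then have Y: "cotton_Y g P c p d = 2 / ?s * cotton g P c p 1 2 d" for d
    by (simp add: cotton_Y_def sum_2 up)
  show "cotton_U g P c p 1 = 2 * (\<Sum>e\<in>UNIV. ginv g c p 2 e * cotton g P c p 1 2 e)"
    "cotton_U g P c p 2 = - 2 * (\<Sum>e\<in>UNIV. ginv g c p 1 e * cotton g P c p 1 2 e)"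
    using s(1) pos by (simp_all add: cotton_U_def vol_form_def sum_2 raise_def Y field_simps)
qed

text \<open>The identity obtained by applying \<open>\<nabla>\<^sub>1\<close> and \<open>\<nabla>\<^sub>2\<close> to
  \<open>\<nabla>\<^sub>a\<nabla>\<^sub>b\<sigma> + P\<^sub>a\<^sub>b\<sigma> + \<Lambda> g\<^sub>a\<^sub>b = 0\<close> and antisymmetrising: the third derivatives of \<open>\<sigma>\<close> leave the
  curvature term, the derivatives of \<open>P\<close> leave the Cotton tensor, and \<open>\<nabla>g = 0\<close> removes the
  undifferentiated \<open>\<Lambda>\<close>.\<close>

lemma hessian_integrability:
  assumes P: "symmetric_tensor A (P g)"
    and \<sigma>: "smooth_in_chart c \<sigma>" and \<Lambda>: "smooth_in_chart c \<Lambda>"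
    and H: "\<And>q a b. q \<in> fst c \<Longrightarrow> nabla1 g c (\<lambda>q d. pd c d \<sigma> q) q a b + P g c q $ a $ b * \<sigma> q + \<Lambda> q * g c q $ a $ b = 0"
    and p: "p \<in> fst c"
  shows "\<sigma> p * cotton g P c p 1 2 b - (\<Sum>e\<in>UNIV. riemann g c p 1 2 b e * pd c e \<sigma> p)
      + P g c p $ 2 $ b * pd c 1 \<sigma> p - P g c p $ 1 $ b * pd c 2 \<sigma> p
      + pd c 1 \<Lambda> p * g c p $ 2 $ b - pd c 2 \<Lambda> p * g c p $ 1 $ b = 0"
proof -
  have Ps: "smooth_in_chart c (\<lambda>q. P g c q $ a $ b)" for a b
    using P c unfolding symmetric_tensor_def by blast
  note sm = metric_smooth[OF g c] christoffel_smooth c \<sigma> \<Lambda> Ps smooth_in_chart_pd[OF c \<sigma>]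
  let ?G = "\<lambda>e a b. christoffel g c p e a b" and ?g = "\<lambda>a b. g c p $ a $ b"
  let ?dG = "\<lambda>i e a b. pd c i (\<lambda>q. christoffel g c q e a b) p"
  let ?dg = "\<lambda>i a b. pd c i (\<lambda>q. g c q $ a $ b) p"
  let ?T = "\<lambda>a b. P g c p $ a $ b" and ?dT = "\<lambda>i a b. pd c i (\<lambda>q. P g c q $ a $ b) p"
  let ?m = "\<lambda>a. pd c a \<sigma> p"
  \<comment> \<open>The hypothesis, solved for the second derivatives of \<open>\<sigma>\<close>; its derivative then gives the third
    ones in terms of first and second ones.\<close>
  have dd: "pd c a (pd c b \<sigma>) q = christoffel g c q 1 a b * pd c 1 \<sigma> q + christoffel g c q 2 a b * pd c 2 \<sigma> q
     - P g c q $ a $ b * \<sigma> q - \<Lambda> q * g c q $ a $ b" if "q \<in> fst c" for q a b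
    using H[OF that, of a b] by (simp add: nabla1_def sum_2)
  have d3: "pd c i (pd c a (pd c b \<sigma>)) p = ?dG i 1 a b * ?m 1 + ?G 1 a b * pd c i (pd c 1 \<sigma>) p
      + (?dG i 2 a b * ?m 2 + ?G 2 a b * pd c i (pd c 2 \<sigma>) p)
      - (?dT i a b * \<sigma> p + ?T a b * ?m i) - (pd c i \<Lambda> p * ?g a b + \<Lambda> p * ?dg i a b)" for i a b
  proof -
    have "pd c i (pd c a (pd c b \<sigma>)) p = pd c i (\<lambda>q. christoffel g c q 1 a b * pd c 1 \<sigma> q + christoffel g c q 2 a b * pd c 2 \<sigma> q
     - P g c q $ a $ b * \<sigma> q - \<Lambda> q * g c q $ a $ b) p"
      by (rule pd_cong[OF c p dd])
    then show ?thesis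
      by (simp add: pd_add pd_diff pd_mult c p sm smooth_intros)
  qed
  have g21: "?g 2 1 = ?g 1 2" by (rule metric_sym[OF g c p])
  have "pd c 1 (pd c 2 (pd c b \<sigma>)) p = pd c 2 (pd c 1 (pd c b \<sigma>)) p"
    by (rule pd_commute[OF c p smooth_in_chart_pd[OF c \<sigma>]])
  then show ?thesis
    unfolding d3 dd[OF p] pd_metric[OF p] cotton_def nabla2_def riemann_def sum_2 g21
      christoffel_sym[OF p, of _ 2 1]
    by (simp add: algebra_simps)
qed

text \<open>The contraction of the integrability identity with \<open>g\<^sup>a\<^sup>b\<close> (no information is lost, as a two-form
  on a surface has one component). The curvature contributes \<open>- K \<nabla>\<^sub>c\<sigma>\<close>, the trace of \<open>P\<close>
  contributes \<open>+ K \<nabla>\<^sub>c\<sigma>\<close>; these cancel exactly because the trace of \<open>P\<close> is the Gauss curvature, and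
  what remains is the third slot of the prolongation connection.\<close>

lemma D_Lambda_vanishes:
  assumes P: "symmetric_tensor A (P g)"
    and tr: "trace_wrt g c p (\<lambda>a b. P g c p $ a $ b) = gauss_curvature g c p"
    and \<sigma>: "smooth_in_chart c \<sigma>" and \<Lambda>: "smooth_in_chart c \<Lambda>"
    and H: "\<And>q a b. q \<in> fst c \<Longrightarrow> nabla1 g c (\<lambda>q d. pd c d \<sigma> q) q a b + P g c q $ a $ b * \<sigma> q + \<Lambda> q * g c q $ a $ b = 0"
    and p: "p \<in> fst c"
  shows "pd c a \<Lambda> p - (\<Sum>d\<in>UNIV. P g c p $ a $ d * raise g c p (\<lambda>e. pd c e \<sigma> p) d)
     + (1/2) * cotton_U g P c p a * \<sigma> p = 0"
proof -
  let ?K = "gauss_curvature g c p" and ?T = "\<lambda>a b. P g c p $ a $ b" and ?m = "\<lambda>a. pd c a \<sigma> p"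
  let ?i = "ginv g c p" and ?g = "\<lambda>a b. g c p $ a $ b"
  note nz = metric_det_nonzero[OF p]
  have T: "?T 2 1 = ?T 1 2" using P c p unfolding symmetric_tensor_def by blast
  have g21: "?g 2 1 = ?g 1 2" by (rule metric_sym[OF g c p])
  have i21: "?i 2 1 = ?i 1 2" by (simp add: ginv_eq nz g21)
  have K: "?K = ?i 1 1 * ?T 1 1 + 2 * ?i 1 2 * ?T 1 2 + ?i 2 2 * ?T 2 2"
    using tr by (simp add: trace_wrt_def sum_2 T i21)
  have E: "\<sigma> p * cotton g P c p 1 2 b = ?K * (?g 2 b * ?m 1 - ?g 1 b * ?m 2)
      - ?T 2 b * ?m 1 + ?T 1 b * ?m 2 - pd c 1 \<Lambda> p * ?g 2 b + pd c 2 \<Lambda> p * ?g 1 b" for b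
    using hessian_integrability[of P \<sigma> \<Lambda> p b, OF P \<sigma> \<Lambda> H p]
    by (simp add: riemann_eq_gauss[OF p] sum_2 algebra_simps)
  have inv: "?i a 1 * ?g b 1 + ?i a 2 * ?g b 2 = (if a = b then 1 else 0)" for a b
    using ginv_lower[of g c p, OF nz, of a "\<lambda>e. if e = b then 1 else 0"]
      exhaust_2[of b] g21 by (auto simp: sum_2)
  \<comment> \<open>For \<open>a = 2\<close> and \<open>a = 1\<close> these contractions are, up to sign, \<open>U\<^sub>1\<sigma>/2\<close> and \<open>U\<^sub>2\<sigma>/2\<close>.\<close>
  have W: "(\<Sum>e\<in>UNIV. ?i a e * (\<sigma> p * cotton g P c p 1 2 e))
     = (?K * ?m 1 - pd c 1 \<Lambda> p) * (?i a 1 * ?g 2 1 + ?i a 2 * ?g 2 2)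
      - (?K * ?m 2 - pd c 2 \<Lambda> p) * (?i a 1 * ?g 1 1 + ?i a 2 * ?g 1 2)
      - (?i a 1 * ?T 2 1 + ?i a 2 * ?T 2 2) * ?m 1 + (?i a 1 * ?T 1 1 + ?i a 2 * ?T 1 2) * ?m 2" for a
    unfolding E sum_2 by (simp add: algebra_simps)
  have "(1/2) * cotton_U g P c p 1 * \<sigma> p = (\<Sum>e\<in>UNIV. ?i 2 e * (\<sigma> p * cotton g P c p 1 2 e))"
    "(1/2) * cotton_U g P c p 2 * \<sigma> p = - (\<Sum>e\<in>UNIV. ?i 1 e * (\<sigma> p * cotton g P c p 1 2 e))"
    by (simp_all add: cotton_U_eq[OF p] sum_2 algebra_simps)
  then have "(1/2) * cotton_U g P c p 1 * \<sigma> p = ?K * ?m 1 - pd c 1 \<Lambda> p - (?i 1 2 * ?T 1 2 + ?i 2 2 * ?T 2 2) * ?m 1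
       + (?i 1 2 * ?T 1 1 + ?i 2 2 * ?T 1 2) * ?m 2"
    "(1/2) * cotton_U g P c p 2 * \<sigma> p = ?K * ?m 2 - pd c 2 \<Lambda> p + (?i 1 1 * ?T 1 2 + ?i 1 2 * ?T 2 2) * ?m 1
       - (?i 1 1 * ?T 1 1 + ?i 1 2 * ?T 1 2) * ?m 2"
    unfolding W inv by (simp_all add: T i21 algebra_simps)
  then show ?thesis
    using exhaust_2[of a] by (auto simp: sum_2 raise_def K T i21 algebra_simps)
qed

end

end


section \<open>Traces and rescaled metrics\<close>

lemma rescale_rescale: "rescale \<Omega> (rescale \<Omega>' g) = rescale (\<lambda>p. \<Omega> p * \<Omega>' p) g"
  by (simp add: rescale_def power_mult_distrib)

lemma ginv_rescale:
  assumes "det (g c p) \<noteq> 0" "\<Omega> p \<noteq> 0"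
  shows "ginv (rescale \<Omega> g) c p a b = ginv g c p a b / (\<Omega> p)\<^sup>2"
proof -
  have d: "det (rescale \<Omega> g c p) = (\<Omega> p)\<^sup>2 * (\<Omega> p)\<^sup>2 * det (g c p)"
    by (simp add: rescale_def det_2 algebra_simps)
  then have nz: "det (rescale \<Omega> g c p) \<noteq> 0" using assms by simp
  have "x * y / (x * x * z) = y / z / x" if "x \<noteq> 0" for x y z :: real
    using that by (simp add: mult.commute)
  from this[of "(\<Omega> p)\<^sup>2"] assms(2) show ?thesis
    using exhaust_2[of a] exhaust_2[of b]
    by (auto simp: ginv_eq[of "rescale \<Omega> g" c p, OF nz] ginv_eq[of g c p, OF assms(1)] d)
      (auto simp: rescale_def)
qed

lemma trace_wrt_rescale:
  assumes "det (g c p) \<noteq> 0" "\<Omega> p \<noteq> 0"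
  shows "trace_wrt (rescale \<Omega> g) c p S = trace_wrt g c p S / (\<Omega> p)\<^sup>2"
  by (simp add: trace_wrt_def sum_2 ginv_rescale[of g c p \<Omega>, OF assms] add_divide_distrib)

lemma trace_wrt_add: "trace_wrt g c p (\<lambda>a b. S a b + T a b) = trace_wrt g c p S + trace_wrt g c p T"
  by (simp add: trace_wrt_def sum_2 algebra_simps)

lemma trace_wrt_scale: "trace_wrt g c p (\<lambda>a b. k * S a b) = k * trace_wrt g c p S"
  by (simp add: trace_wrt_def sum_2 algebra_simps)

lemma Upsilon_sq_trace: "Upsilon_sq g \<Omega> c p = trace_wrt g c p (\<lambda>a b. Upsilon \<Omega> c p a * Upsilon \<Omega> c p b)"
  by (simp add: Upsilon_sq_def trace_wrt_def raise_def sum_2 algebra_simps)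

lemma raise_inner_trace:
  "(\<Sum>b\<in>UNIV. raise g c p v b * w b) = trace_wrt g c p (\<lambda>a b. w a * v b)"
  by (simp add: trace_wrt_def raise_def sum_2 algebra_simps)

lemma rescale_metric:
  assumes o: "oriented_surface A" and g: "riemannian_metric A g" and \<Omega>: "conformal_factor A \<Omega>"
  shows "riemannian_metric A (rescale \<Omega> g)"
proof -
  interpret oriented_surface A by fact
  have sm: "smooth_in_chart c \<Omega>" if "c \<in> A" for c
    using \<Omega> that unfolding conformal_factor_def smooth_fun_def by blast
  have pos: "\<Omega> p > 0" for p using \<Omega> unfolding conformal_factor_def by blast
  note T = g[unfolded riemannian_metric_def symmetric_tensor_def]
  have "symmetric_tensor A (rescale \<Omega> g)"
    unfolding symmetric_tensor_def
  proof (intro conjI ballI allI impI)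
    fix c a b assume "c \<in> A"
    then show "smooth_in_chart c (\<lambda>p. rescale \<Omega> g c p $ a $ b)"
      by (simp add: rescale_def power2_eq_square smooth_intros sm metric_smooth[OF g])
  next
    fix c p a b assume "c \<in> A" "p \<in> fst c"
    then show "rescale \<Omega> g c p $ a $ b = rescale \<Omega> g c p $ b $ a"
      by (simp add: rescale_def metric_sym[OF g])
  next
    fix c d p a b assume "c \<in> A" "d \<in> A" "p \<in> fst c \<inter> fst d"
    then have "g c p $ a $ b =
        (\<Sum>i\<in>UNIV. \<Sum>j\<in>UNIV. jacobian c d p $ i $ a * jacobian c d p $ j $ b * g d p $ i $ j)"
      using T by blast
    then show "rescale \<Omega> g c p $ a $ b =
        (\<Sum>i\<in>UNIV. \<Sum>j\<in>UNIV. jacobian c d p $ i $ a * jacobian c d p $ j $ b * rescale \<Omega> g d p $ i $ j)"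
      by (simp add: rescale_def sum_distrib_left mult_ac)
  next
    fix c p assume "c \<notin> A \<or> p \<notin> fst c"
    then have "g c p = 0" using T by blast
    then show "rescale \<Omega> g c p = 0" by (simp add: rescale_def)
  qed
  moreover have "v \<bullet> (rescale \<Omega> g c p *v v) > 0" if "c \<in> A" "p \<in> fst c" "v \<noteq> 0" for c p v
  proof -
    have "v \<bullet> (rescale \<Omega> g c p *v v) = (\<Omega> p)\<^sup>2 * (v \<bullet> (g c p *v v))"
      by (simp add: rescale_def inner_vec_def matrix_vector_mult_def sum_2 algebra_simps)
    then show ?thesis using T that pos[of p] by simp
  qed
  ultimately show ?thesis unfolding riemannian_metric_def by blast
qed

context oriented_surface
begin

text \<open>If the metrics satisfy \<open>g\<^sub>c = J\<^sup>T g\<^sub>d J\<close>, then the push-forward \<open>N = J g\<^sub>c\<^sup>-\<^sup>1 J\<^sup>T\<close> of the inverse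
  is \<open>g\<^sub>d\<^sup>-\<^sup>1\<close>. For two by two matrices this is a polynomial identity between adjugates, once both
  sides are multiplied by the determinants.\<close>

lemma trace_wrt_transform:
  assumes g: "riemannian_metric A g" and c: "c \<in> A" "d \<in> A" "p \<in> fst c \<inter> fst d"
    and S: "\<And>a b. S a b = (\<Sum>i\<in>UNIV. \<Sum>j\<in>UNIV. jacobian c d p $ i $ a * jacobian c d p $ j $ b * T i j)"
  shows "trace_wrt g c p S = trace_wrt g d p T"
proof -
  let ?J = "\<lambda>i a. jacobian c d p $ i $ a" and ?D = "det (jacobian c d p)"
  let ?h = "\<lambda>i j. g d p $ i $ j"
  have gc: "g c p $ a $ b = (\<Sum>i\<in>UNIV. \<Sum>j\<in>UNIV. ?J i a * ?J j b * ?h i j)" for a b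
    using g c unfolding riemannian_metric_def symmetric_tensor_def by blast
  have D: "?D \<noteq> 0" using transition_oriented[OF c] by simp
  have ncd: "det (g c p) \<noteq> 0" "det (g d p) \<noteq> 0"
    using metric_det_pos[OF g] c by (metis IntD1 less_irrefl, metis IntD2 less_irrefl)
  have det: "det (g c p) = ?D * ?D * det (g d p)"
    unfolding det_2 gc sum_2 by (simp add: algebra_simps)
  define N where "N = (\<lambda>i j. \<Sum>a\<in>UNIV. \<Sum>b\<in>UNIV. ginv g c p a b * ?J i a * ?J j b)"
  have adj: "ginv g q p 1 1 * det (g q p) = g q p $ 2 $ 2" "ginv g q p 1 2 * det (g q p) = - g q p $ 1 $ 2"
    "ginv g q p 2 1 * det (g q p) = - g q p $ 2 $ 1" "ginv g q p 2 2 * det (g q p) = g q p $ 1 $ 1"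
    if "det (g q p) \<noteq> 0" for q
    using that by (simp_all add: ginv_eq)
  have "N i j * det (g c p) = (ginv g c p 1 1 * det (g c p)) * ?J i 1 * ?J j 1 + (ginv g c p 1 2 * det (g c p)) * ?J i 1 * ?J j 2
     + (ginv g c p 2 1 * det (g c p)) * ?J i 2 * ?J j 1 + (ginv g c p 2 2 * det (g c p)) * ?J i 2 * ?J j 2" for i j
    by (simp add: N_def sum_2 algebra_simps)
  then have Nc: "N i j * det (g c p) = g c p $ 2 $ 2 * ?J i 1 * ?J j 1 - g c p $ 1 $ 2 * ?J i 1 * ?J j 2
     - g c p $ 2 $ 1 * ?J i 2 * ?J j 1 + g c p $ 1 $ 1 * ?J i 2 * ?J j 2" for i j
    unfolding adj[OF ncd(1)] by simp
  have Nd: "N i j * det (g c p) = ?D * ?D * (ginv g d p i j * det (g d p))" for i j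
    unfolding Nc gc sum_2 using exhaust_2[of i] exhaust_2[of j]
    by (elim disjE; simp only: adj[OF ncd(2)]) (simp_all add: det_2 algebra_simps)
  have N: "N i j = ginv g d p i j" for i j
    using Nd[of i j] ncd D unfolding det by simp
  have "trace_wrt g c p S = (\<Sum>i\<in>UNIV. \<Sum>j\<in>UNIV. N i j * T i j)"
    unfolding trace_wrt_def S N_def sum_2 by (simp add: algebra_simps)
  then show ?thesis by (simp add: N trace_wrt_def)
qed

lemma pd_divide:
  assumes c: "c \<in> A" "p \<in> fst c" and f: "smooth_in_chart c f" and h: "smooth_in_chart c h"
    and nz: "\<And>q. q \<in> fst c \<Longrightarrow> h q \<noteq> 0"
  shows "pd c a (\<lambda>q. f q / h q) p = (pd c a f p - f p / h p * pd c a h p) / h p"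
proof -
  have "pd c a f p = pd c a (\<lambda>q. f q / h q * h q) p" by (rule pd_cong[OF c]) (simp add: nz)
  also have "\<dots> = pd c a (\<lambda>q. f q / h q) p * h p + f p / h p * pd c a h p"
    by (rule pd_mult[OF c smooth_in_chart_divide[OF c(1) nz f h] h])
  finally show ?thesis using nz[OF c(2)] by (simp add: field_simps)
qed

end


section \<open>The tractor of a nowhere vanishing density\<close>

definition hessian_P :: "'m metric \<Rightarrow> ('m metric \<Rightarrow> 'm bilinear_field) \<Rightarrow> 'm chart \<Rightarrow> 'm density \<Rightarrow>
    'm \<Rightarrow> 2 \<Rightarrow> 2 \<Rightarrow> real" where
  "hessian_P g P c \<sigma> p a b = nabla1 g c (\<lambda>q d. pd c d (\<sigma> g) q) p a b + P g c p $ a $ b * \<sigma> g p"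

text \<open>The only candidate for \<open>\<Lambda>\<close>. A function on the surface has no chart argument, so at every point
  some chart is chosen; for densities without zeros the value is the same in all charts.\<close>

definition bottom_slot :: "'m chart set \<Rightarrow> ('m metric \<Rightarrow> 'm bilinear_field) \<Rightarrow> 'm density \<Rightarrow>
    'm metric \<Rightarrow> 'm \<Rightarrow> real" where
  "bottom_slot A P \<sigma> g p =
    (let c = (SOME c. c \<in> A \<and> p \<in> fst c) in - (1/2) * trace_wrt g c p (hessian_P g P c \<sigma> p))"

text \<open>The zeros at charts and points without meaning, and outside the conformal class, are those that a
  tractor section must have; they make the tractor with a given scale unique as a map.\<close>

definition scale_tractor :: "'m chart set \<Rightarrow> 'm metric set \<Rightarrow> ('m metric \<Rightarrow> 'm bilinear_field) \<Rightarrow>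
    'm density \<Rightarrow> 'm tractor" where
  "scale_tractor A C P \<sigma> = (\<lambda>g. if g \<in> C
     then (\<sigma> g, \<lambda>c p. if c \<in> A \<and> p \<in> fst c then \<chi> a. pd c a (\<sigma> g) p else 0, bottom_slot A P \<sigma> g)
     else (\<lambda>p. 0, \<lambda>c p. 0, \<lambda>p. 0))"

text \<open>The metric of the class in which \<open>\<sigma>\<close> has absolute value \<open>1\<close>.\<close>

definition unit_scale_metric :: "'m density \<Rightarrow> 'm metric \<Rightarrow> 'm metric" where
  "unit_scale_metric \<sigma> g = rescale (\<lambda>p. 1 / \<bar>\<sigma> g p\<bar>) g"

context moebius_surface
begin

lemma C_metric: assumes "g \<in> C" shows "riemannian_metric A g"
proof -
  obtain g0 \<Omega> where "riemannian_metric A g0" "g = rescale \<Omega> g0" "conformal_factor A \<Omega>"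
    using assms conformal unfolding conformal_class_def by blast
  then show ?thesis using rescale_metric[OF oriented_surface_axioms] by blast
qed

lemma conformal_factor_smooth: "conformal_factor A \<Omega> \<Longrightarrow> c \<in> A \<Longrightarrow> smooth_in_chart c \<Omega>"
  unfolding conformal_factor_def smooth_fun_def by blast

lemma conformal_factor_pos: "conformal_factor A \<Omega> \<Longrightarrow> \<Omega> p > 0"
  unfolding conformal_factor_def by blast

lemma C_rescale: assumes "g \<in> C" "conformal_factor A \<Omega>" shows "rescale \<Omega> g \<in> C"
proof -
  obtain g0 where C: "C = {rescale \<Omega> g0 | \<Omega>. conformal_factor A \<Omega>}"
    using conformal unfolding conformal_class_def by blast
  then obtain \<Omega>' where g: "g = rescale \<Omega>' g0" and \<Omega>': "conformal_factor A \<Omega>'"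
    using assms by blast
  have "conformal_factor A (\<lambda>p. \<Omega> p * \<Omega>' p)"
    using assms(2) \<Omega>' by (auto simp: conformal_factor_def smooth_fun_def smooth_in_chart_mult)
  then show ?thesis unfolding C g rescale_rescale by blast
qed

lemma P_smooth: "g \<in> C \<Longrightarrow> c \<in> A \<Longrightarrow> smooth_in_chart c (\<lambda>p. P g c p $ a $ b)"
  using P_tensor unfolding symmetric_tensor_def by blast

lemma C_det_nonzero: "g \<in> C \<Longrightarrow> c \<in> A \<Longrightarrow> p \<in> fst c \<Longrightarrow> det (g c p) \<noteq> 0"
  using metric_det_nonzero C_metric by blast

lemma trace_wrt_self:
  assumes g: "g \<in> C" and c: "c \<in> A" "p \<in> fst c"
  shows "trace_wrt g c p (\<lambda>a b. g c p $ a $ b) = 2"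
proof -
  have "(\<Sum>b\<in>UNIV. ginv g c p a b * g c p $ a $ b) = 1" for a
    using ginv_lower[of g c p, OF C_det_nonzero[OF g c], of a "\<lambda>f. if f = a then 1 else 0"]
      exhaust_2[of a] metric_sym[OF C_metric[OF g] c, of 2 1] by (auto simp: sum_2)
  then show ?thesis by (simp add: trace_wrt_def)
qed

lemma Upsilon_eq:
  "conformal_factor A \<Omega> \<Longrightarrow> c \<in> A \<Longrightarrow> p \<in> fst c \<Longrightarrow> Upsilon \<Omega> c p a = pd c a \<Omega> p / \<Omega> p"
  unfolding Upsilon_def by (intro pd_ln conformal_factor_smooth conformal_factor_pos)

lemma hessian_P_smooth:
  assumes "g \<in> C" "c \<in> A" "smooth_in_chart c (\<sigma> g)"
  shows "smooth_in_chart c (\<lambda>p. hessian_P g P c \<sigma> p a b)"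
  unfolding hessian_P_def nabla1_def
  by (intro smooth_intros smooth_in_chart_pd christoffel_smooth C_metric P_smooth assms)

context
  fixes \<sigma> :: "'m density"
  assumes \<sigma>: "weight1_density A C \<sigma>" and nv: "nowhere_vanishing C \<sigma>"
begin

lemma density_smooth: "g \<in> C \<Longrightarrow> c \<in> A \<Longrightarrow> smooth_in_chart c (\<sigma> g)"
  using \<sigma> unfolding weight1_density_def smooth_fun_def by blast

lemma density_nonzero: "g \<in> C \<Longrightarrow> \<sigma> g p \<noteq> 0"
  using nv unfolding nowhere_vanishing_def by blast

lemma density_rescale: "g \<in> C \<Longrightarrow> conformal_factor A \<Omega> \<Longrightarrow> \<sigma> (rescale \<Omega> g) p = \<Omega> p * \<sigma> g p"
  using \<sigma> unfolding weight1_density_def by blast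

lemma unit_scale_factor:
  assumes "g \<in> C" shows "conformal_factor A (\<lambda>p. 1 / \<bar>\<sigma> g p\<bar>)"
proof -
  have "smooth_in_chart c (\<lambda>p. 1 / \<bar>\<sigma> g p\<bar>)" if c: "c \<in> A" for c
  proof (rule smooth_in_chart_cong[OF c])
    show "smooth_in_chart c (\<lambda>p. sgn (\<sigma> g p) / \<sigma> g p)"
      by (intro smooth_in_chart_divide smooth_in_chart_sgn density_smooth density_nonzero assms c)
    show "sgn (\<sigma> g p) / \<sigma> g p = 1 / \<bar>\<sigma> g p\<bar>" for p
      using density_nonzero[OF assms, of p] by (simp add: sgn_if)
  qed
  then show ?thesis
    using density_nonzero[OF assms] by (simp add: conformal_factor_def smooth_fun_def)
qed

lemma unit_scale_metric_in: "g \<in> C \<Longrightarrow> unit_scale_metric \<sigma> g \<in> C"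
  unfolding unit_scale_metric_def by (intro C_rescale unit_scale_factor)

text \<open>The weight of \<open>\<sigma>\<close> makes \<open>\<sigma>\<^sup>-\<^sup>2g\<close> independent of the representative \<open>g\<close>. Quantities computed
  from this metric are therefore the same for all representatives.\<close>

lemma unit_scale_metric_rescale:
  assumes "g \<in> C" "conformal_factor A \<Omega>"
  shows "unit_scale_metric \<sigma> (rescale \<Omega> g) = unit_scale_metric \<sigma> g"
proof -
  have "1 / \<bar>\<sigma> (rescale \<Omega> g) p\<bar> * \<Omega> p = 1 / \<bar>\<sigma> g p\<bar>" for p
    using conformal_factor_pos[OF assms(2), of p] by (simp add: density_rescale assms abs_mult)
  then show ?thesis unfolding unit_scale_metric_def rescale_rescale by simp
qed

lemma Upsilon_unit_scale:
  assumes g: "g \<in> C" and c: "c \<in> A" "p \<in> fst c"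
  shows "Upsilon (\<lambda>p. 1 / \<bar>\<sigma> g p\<bar>) c p a = - pd c a (\<sigma> g) p / \<sigma> g p"
proof -
  note nz = density_nonzero[OF g] and sm = density_smooth[OF g c(1)]
  have sq: "smooth_in_chart c (\<lambda>q. \<sigma> g q * \<sigma> g q)" by (intro smooth_intros c sm)
  have pos: "\<sigma> g q * \<sigma> g q > 0" for q using nz[of q] by (metis not_real_square_gt_zero)
  have lnsm: "pd c a (\<lambda>q. (-1/2) * ln (\<sigma> g q * \<sigma> g q)) p = (-1/2) * pd c a (\<lambda>q. ln (\<sigma> g q * \<sigma> g q)) p"
  proof -
    have d: "((\<lambda>y. ln ((\<sigma> g (chart_inv c y)) * (\<sigma> g (chart_inv c y)))) has_derivative
      (\<lambda>v. frechet_derivative (\<lambda>y. \<sigma> g (chart_inv c y) * \<sigma> g (chart_inv c y)) (at (snd c p)) v * inverse (\<sigma> g p * \<sigma> g p))) (at (snd c p))"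
      using has_derivative_ln[OF _ smooth_in_chart_has_derivative[OF c sq]] pos[of p]
      by (simp add: chart_inv_left c o_def)
    show ?thesis
      using pd_eqI[of "\<lambda>q. ln (\<sigma> g q * \<sigma> g q)", unfolded o_def, OF d, of a]
        pd_eqI[of "\<lambda>q. (-1/2) * ln (\<sigma> g q * \<sigma> g q)", unfolded o_def, OF has_derivative_mult_right[OF d], of a]
      by simp
  qed
  \<comment> \<open>The square replaces the absolute value by a smooth expression.\<close>
  have ln: "ln (1 / \<bar>\<sigma> g q\<bar>) = (-1/2) * ln (\<sigma> g q * \<sigma> g q)" for q
  proof -
    have "ln (\<sigma> g q * \<sigma> g q) = ln (\<bar>\<sigma> g q\<bar> * \<bar>\<sigma> g q\<bar>)" by simp
    also have "\<dots> = 2 * ln \<bar>\<sigma> g q\<bar>" using nz[of q] by (subst ln_mult) auto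
    finally show ?thesis using nz[of q] by (simp add: ln_div)
  qed
  have "Upsilon (\<lambda>p. 1 / \<bar>\<sigma> g p\<bar>) c p a = (-1/2) * (pd c a (\<lambda>q. \<sigma> g q * \<sigma> g q) p / (\<sigma> g p * \<sigma> g p))"
    unfolding Upsilon_def ln lnsm by (subst pd_ln[OF c sq pos]) simp
  also have "\<dots> = - pd c a (\<sigma> g) p / \<sigma> g p"
    using nz[of p] by (simp add: pd_mult[OF c sm sm])
  finally show ?thesis .
qed

text \<open>The transformation law of \<open>P\<close> for \<open>\<Omega> = 1/\<bar>\<sigma>\<bar>\<close>, where \<open>\<Upsilon> = - d\<sigma>/\<sigma>\<close>: the second derivatives of
  \<open>\<sigma>\<close> in \<open>\<nabla>\<Upsilon>\<close> combine with \<open>P\<close> to the left-hand side, and the terms \<open>\<Upsilon>\<^sub>a\<Upsilon>\<^sub>b\<close> cancel. The right-hand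
  side has only first derivatives of \<open>\<sigma>\<close> and a tensor that belongs to a fixed metric, so its
  behaviour under changes of chart and of metric is known.\<close>

lemma hessian_P_unit_scale:
  assumes g: "g \<in> C" and c: "c \<in> A" "p \<in> fst c"
  shows "hessian_P g P c \<sigma> p a b = \<sigma> g p * P (unit_scale_metric \<sigma> g) c p $ a $ b
    + (trace_wrt g c p (\<lambda>a b. pd c a (\<sigma> g) p * pd c b (\<sigma> g) p) / (2 * \<sigma> g p)) * g c p $ a $ b"
proof -
  note nz = density_nonzero[OF g] and sm = density_smooth[OF g c(1)]
  let ?\<Omega> = "\<lambda>p. 1 / \<bar>\<sigma> g p\<bar>" and ?s = "\<sigma> g p" and ?d = "\<lambda>a. pd c a (\<sigma> g) p"
  have "pd c a (\<lambda>q. Upsilon ?\<Omega> c q b) p = pd c a (\<lambda>q. (- pd c b (\<sigma> g) q) / \<sigma> g q) p"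
    by (rule pd_cong[OF c]) (rule Upsilon_unit_scale[OF g c(1)])
  also have "\<dots> = (pd c a (\<lambda>q. - pd c b (\<sigma> g) q) p - (- ?d b) / ?s * ?d a) / ?s"
    by (rule pd_divide[OF c _ sm nz]) (intro smooth_intros smooth_in_chart_pd c sm)
  also have "pd c a (\<lambda>q. - pd c b (\<sigma> g) q) p = - pd c a (pd c b (\<sigma> g)) p"
    using pd_mult[OF c smooth_in_chart_const[OF c(1), of "-1"] smooth_in_chart_pd[OF c(1) sm]] by simp
  finally have pdU: "pd c a (\<lambda>q. Upsilon ?\<Omega> c q b) p = (- pd c a (pd c b (\<sigma> g)) p - (- ?d b) / ?s * ?d a) / ?s" .
  have n: "nabla1 g c (Upsilon ?\<Omega> c) p a b
     = - nabla1 g c (\<lambda>q d. pd c d (\<sigma> g) q) p a b / ?s + ?d a * ?d b / (?s * ?s)"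
    unfolding nabla1_def sum_2 pdU Upsilon_unit_scale[OF g c] using nz[of p] by (simp add: field_simps)
  have U: "Upsilon_sq g ?\<Omega> c p = trace_wrt g c p (\<lambda>a b. ?d a * ?d b) / (?s * ?s)"
    by (simp add: Upsilon_sq_trace Upsilon_unit_scale[OF g c] trace_wrt_def sum_2 add_divide_distrib)
  have e: "P (unit_scale_metric \<sigma> g) c p $ a $ b = P g c p $ a $ b
      + nabla1 g c (\<lambda>q d. pd c d (\<sigma> g) q) p a b / ?s
      - (1/2) * g c p $ a $ b * (trace_wrt g c p (\<lambda>a b. ?d a * ?d b) / (?s * ?s))"
    unfolding unit_scale_metric_def P_rescale[OF g unit_scale_factor[OF g] c] n U Upsilon_unit_scale[OF g c]
    by simp
  show ?thesis unfolding hessian_P_def e using nz[of p] by (simp add: field_simps)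
qed

lemma trace_hessian_P:
  assumes g: "g \<in> C" and c: "c \<in> A" "p \<in> fst c"
  shows "trace_wrt g c p (hessian_P g P c \<sigma> p) =
    (trace_wrt (unit_scale_metric \<sigma> g) c p (\<lambda>a b. P (unit_scale_metric \<sigma> g) c p $ a $ b)
     + trace_wrt g c p (\<lambda>a b. pd c a (\<sigma> g) p * pd c b (\<sigma> g) p)) / \<sigma> g p"
proof -
  let ?g = "unit_scale_metric \<sigma> g"
  have t: "trace_wrt ?g c p S = trace_wrt g c p S * (\<sigma> g p * \<sigma> g p)" for S
    unfolding unit_scale_metric_def
    using density_nonzero[OF g, of p] C_det_nonzero[OF g c]
    by (subst trace_wrt_rescale) (auto simp: power2_eq_square)
  let ?T = "trace_wrt g c p (\<lambda>a b. pd c a (\<sigma> g) p * pd c b (\<sigma> g) p)"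
  have h: "hessian_P g P c \<sigma> p = (\<lambda>a b. \<sigma> g p * P ?g c p $ a $ b + ?T / (2 * \<sigma> g p) * g c p $ a $ b)"
    by (intro ext hessian_P_unit_scale[OF g c])
  have "trace_wrt g c p (hessian_P g P c \<sigma> p)
      = \<sigma> g p * trace_wrt g c p (\<lambda>a b. P ?g c p $ a $ b) + ?T / (2 * \<sigma> g p) * 2"
    unfolding h trace_wrt_add trace_wrt_scale trace_wrt_self[OF g c] ..
  then show ?thesis
    unfolding t using density_nonzero[OF g, of p] by (simp add: add_divide_distrib)
qed

text \<open>Both traces in \<open>trace_hessian_P\<close> are invariants of tensors.\<close>

lemma bottom_slot_eq:
  assumes g: "g \<in> C" and c: "c \<in> A" "p \<in> fst c"
  shows "bottom_slot A P \<sigma> g p = - (1/2) * trace_wrt g c p (hessian_P g P c \<sigma> p)"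
proof -
  define d where "d = (SOME c. c \<in> A \<and> p \<in> fst c)"
  have d: "d \<in> A" "p \<in> fst d" using someI[of "\<lambda>c. c \<in> A \<and> p \<in> fst c" c] c unfolding d_def by auto
  let ?g = "unit_scale_metric \<sigma> g"
  have p: "p \<in> fst c \<inter> fst d" using c d by blast
  have P: "P ?g c p $ a $ b = (\<Sum>i\<in>UNIV. \<Sum>j\<in>UNIV. jacobian c d p $ i $ a * jacobian c d p $ j $ b * P ?g d p $ i $ j)" for a b
    using P_tensor[OF unit_scale_metric_in[OF g]] c d p unfolding symmetric_tensor_def by blast
  have 1: "trace_wrt ?g c p (\<lambda>a b. P ?g c p $ a $ b) = trace_wrt ?g d p (\<lambda>a b. P ?g d p $ a $ b)"
    by (rule trace_wrt_transform[OF C_metric[OF unit_scale_metric_in[OF g]] c(1) d(1) p P])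
  have 2: "trace_wrt g c p (\<lambda>a b. pd c a (\<sigma> g) p * pd c b (\<sigma> g) p)
      = trace_wrt g d p (\<lambda>a b. pd d a (\<sigma> g) p * pd d b (\<sigma> g) p)"
    by (rule trace_wrt_transform[OF C_metric[OF g] c(1) d(1) p])
      (simp add: pd_transform[OF c(1) d(1) p density_smooth[OF g d(1)]] sum_2 algebra_simps)
  have "trace_wrt g c p (hessian_P g P c \<sigma> p) = trace_wrt g d p (hessian_P g P d \<sigma> p)"
    unfolding trace_hessian_P[OF g c] trace_hessian_P[OF g d] 1 2 ..
  then show ?thesis by (simp add: bottom_slot_def d_def Let_def)
qed

lemma bottom_slot_smooth:
  assumes "g \<in> C" "c \<in> A"
  shows "smooth_in_chart c (bottom_slot A P \<sigma> g)"
proof -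
  have "smooth_in_chart c (\<lambda>p. - (1/2) * trace_wrt g c p (hessian_P g P c \<sigma> p))"
    unfolding trace_wrt_def
    by (intro smooth_intros ginv_smooth hessian_P_smooth C_metric density_smooth assms)
  then show ?thesis
    by (rule smooth_in_chart_cong[OF assms(2), rotated]) (simp add: bottom_slot_eq[OF assms])
qed

lemma pd_density_rescale:
  assumes g: "g \<in> C" and \<Omega>: "conformal_factor A \<Omega>" and c: "c \<in> A" "p \<in> fst c"
  shows "pd c a (\<sigma> (rescale \<Omega> g)) p = \<Omega> p * (pd c a (\<sigma> g) p + Upsilon \<Omega> c p a * \<sigma> g p)"
proof -
  have "pd c a (\<sigma> (rescale \<Omega> g)) p = pd c a (\<lambda>q. \<Omega> q * \<sigma> g q) p"
    by (rule pd_cong[OF c]) (rule density_rescale[OF g \<Omega>])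
  also have "\<dots> = pd c a \<Omega> p * \<sigma> g p + \<Omega> p * pd c a (\<sigma> g) p"
    by (rule pd_mult[OF c conformal_factor_smooth[OF \<Omega> c(1)] density_smooth[OF g c(1)]])
  finally show ?thesis
    using conformal_factor_pos[OF \<Omega>, of p] by (simp add: Upsilon_eq[OF \<Omega> c] field_simps)
qed

text \<open>By \<open>trace_hessian_P\<close>, \<open>\<Lambda> = - (K' + \<bar>d\<sigma>\<bar>\<^sup>2) / (2 \<sigma>)\<close>, where \<open>K'\<close> is the same for all metrics of the class.
  Expanding the square of \<open>\<Omega> (d\<sigma> + \<sigma> \<Upsilon>)\<close> in the rescaled metric gives the three terms of the tractor
  law.\<close>

lemma bottom_slot_rescale:
  assumes g: "g \<in> C" and \<Omega>: "conformal_factor A \<Omega>" and c: "c \<in> A" "p \<in> fst c"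
  shows "bottom_slot A P \<sigma> (rescale \<Omega> g) p = inverse (\<Omega> p) * (bottom_slot A P \<sigma> g p
     - (\<Sum>b\<in>UNIV. raise g c p (Upsilon \<Omega> c p) b * pd c b (\<sigma> g) p)
     - (1/2) * Upsilon_sq g \<Omega> c p * \<sigma> g p)"
proof -
  let ?t = "trace_wrt g c p" and ?d = "\<lambda>a. pd c a (\<sigma> g) p" and ?U = "Upsilon \<Omega> c p"
    and ?s = "\<sigma> g p" and ?w = "\<Omega> p"
  let ?K = "trace_wrt (unit_scale_metric \<sigma> g) c p (\<lambda>a b. P (unit_scale_metric \<sigma> g) c p $ a $ b)"
  have w: "?w \<noteq> 0" using conformal_factor_pos[OF \<Omega>, of p] by simp
  have s: "?s \<noteq> 0" by (rule density_nonzero[OF g])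
  have sym: "ginv g c p 2 1 = ginv g c p 1 2"
    using C_det_nonzero[OF g c] metric_sym[OF C_metric[OF g] c, of 2 1] by (simp add: ginv_eq)
  have "trace_wrt (rescale \<Omega> g) c p (\<lambda>a b. pd c a (\<sigma> (rescale \<Omega> g)) p * pd c b (\<sigma> (rescale \<Omega> g)) p)
      = ?t (\<lambda>a b. (?w * (?d a + ?U a * ?s)) * (?w * (?d b + ?U b * ?s))) / ?w\<^sup>2"
    unfolding pd_density_rescale[OF g \<Omega> c] by (rule trace_wrt_rescale[of g c p \<Omega>, OF C_det_nonzero[OF g c] w])
  also have "?t (\<lambda>a b. (?w * (?d a + ?U a * ?s)) * (?w * (?d b + ?U b * ?s)))
      = ?w\<^sup>2 * (?t (\<lambda>a b. ?d a * ?d b) + 2 * ?s * ?t (\<lambda>a b. ?d a * ?U b) + ?s * ?s * ?t (\<lambda>a b. ?U a * ?U b))"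
    by (simp add: trace_wrt_def sum_2 sym power2_eq_square algebra_simps)
  finally have T: "trace_wrt (rescale \<Omega> g) c p (\<lambda>a b. pd c a (\<sigma> (rescale \<Omega> g)) p * pd c b (\<sigma> (rescale \<Omega> g)) p)
      = ?t (\<lambda>a b. ?d a * ?d b) + 2 * ?s * ?t (\<lambda>a b. ?d a * ?U b) + ?s * ?s * ?t (\<lambda>a b. ?U a * ?U b)"
    using w by simp
  have l: "bottom_slot A P \<sigma> (rescale \<Omega> g) p = - (1/2) * ((?K + (?t (\<lambda>a b. ?d a * ?d b)
      + 2 * ?s * ?t (\<lambda>a b. ?d a * ?U b) + ?s * ?s * ?t (\<lambda>a b. ?U a * ?U b))) / (?w * ?s))"
    unfolding bottom_slot_eq[OF C_rescale[OF g \<Omega>] c] trace_hessian_P[OF C_rescale[OF g \<Omega>] c]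
      unit_scale_metric_rescale[OF g \<Omega>] density_rescale[OF g \<Omega>] T ..
  have r: "bottom_slot A P \<sigma> g p = - (1/2) * ((?K + ?t (\<lambda>a b. ?d a * ?d b)) / ?s)"
    unfolding bottom_slot_eq[OF g c] trace_hessian_P[OF g c] ..
  show ?thesis
    unfolding l r raise_inner_trace Upsilon_sq_trace using w s by (simp add: field_simps)
qed

lemma scale_tractor_section: "tractor_section A C (scale_tractor A C P \<sigma>)"
  unfolding tractor_section_def
proof (intro conjI ballI allI impI)
  fix g assume g: "g \<in> C"
  show "smooth_fun A (slot_sigma (scale_tractor A C P \<sigma>) g)"
    using g density_smooth by (simp add: smooth_fun_def slot_sigma_def scale_tractor_def)
  show "smooth_fun A (slot_Lambda (scale_tractor A C P \<sigma>) g)"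
    using g bottom_slot_smooth by (simp add: smooth_fun_def slot_Lambda_def scale_tractor_def)
  show "one_form A (slot_mu (scale_tractor A C P \<sigma>) g)"
    unfolding one_form_def
  proof (intro conjI ballI allI impI)
    fix c a assume c: "c \<in> A"
    show "smooth_in_chart c (\<lambda>p. slot_mu (scale_tractor A C P \<sigma>) g c p $ a)"
      by (rule smooth_in_chart_cong[OF c _ smooth_in_chart_pd[OF c density_smooth[OF g c], of a]])
        (simp add: slot_mu_def scale_tractor_def g c)
  next
    fix c d p a assume c: "c \<in> A" "d \<in> A" "p \<in> fst c \<inter> fst d"
    then show "slot_mu (scale_tractor A C P \<sigma>) g c p $ a
      = (\<Sum>i\<in>UNIV. jacobian c d p $ i $ a * slot_mu (scale_tractor A C P \<sigma>) g d p $ i)"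
      using pd_transform[OF c density_smooth[OF g c(2)]] by (simp add: slot_mu_def scale_tractor_def g)
  next
    fix c p assume "c \<notin> A \<or> p \<notin> fst c"
    then show "slot_mu (scale_tractor A C P \<sigma>) g c p = 0"
      by (auto simp: slot_mu_def scale_tractor_def)
  qed
next
  fix g \<Omega> c p
  assume g: "g \<in> C" and \<Omega>: "conformal_factor A \<Omega>" and c: "c \<in> A" "p \<in> fst c"
  note r = C_rescale[OF g \<Omega>]
  show "slot_sigma (scale_tractor A C P \<sigma>) (rescale \<Omega> g) p = \<Omega> p * slot_sigma (scale_tractor A C P \<sigma>) g p"
    by (simp add: slot_sigma_def scale_tractor_def g r density_rescale[OF g \<Omega>])
  show "slot_mu (scale_tractor A C P \<sigma>) (rescale \<Omega> g) c p $ a =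
      \<Omega> p * (slot_mu (scale_tractor A C P \<sigma>) g c p $ a + Upsilon \<Omega> c p a * slot_sigma (scale_tractor A C P \<sigma>) g p)" for a
    by (simp add: slot_sigma_def slot_mu_def scale_tractor_def g r c pd_density_rescale[OF g \<Omega> c])
  show "slot_Lambda (scale_tractor A C P \<sigma>) (rescale \<Omega> g) p = inverse (\<Omega> p) *
          (slot_Lambda (scale_tractor A C P \<sigma>) g p
           - (\<Sum>b\<in>UNIV. raise g c p (Upsilon \<Omega> c p) b * slot_mu (scale_tractor A C P \<sigma>) g c p $ b)
           - (1/2) * Upsilon_sq g \<Omega> c p * slot_sigma (scale_tractor A C P \<sigma>) g p)"
    using bottom_slot_rescale[OF g \<Omega> c]
    by (simp add: slot_sigma_def slot_mu_def slot_Lambda_def scale_tractor_def g r c)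
qed (auto simp: scale_tractor_def)

lemma scale_tractor_parallel:
  assumes E: "conformal_einstein A C P \<sigma>"
  shows "parallel A C P (scale_tractor A C P \<sigma>)"
proof -
  let ?I = "scale_tractor A C P \<sigma>"
  have "D_sigma g ?I c p a = 0 \<and> (\<forall>b. D_mu g P ?I c p a b = 0) \<and> D_Lambda g P ?I c p a = 0"
    if g: "g \<in> C" and c: "c \<in> A" and p: "p \<in> fst c" for g c p a
  proof -
    have \<sigma>': "slot_sigma ?I g = \<sigma> g" and \<Lambda>: "slot_Lambda ?I g = bottom_slot A P \<sigma> g"
      and \<mu>: "\<And>q d. q \<in> fst c \<Longrightarrow> slot_mu ?I g c q $ d = pd c d (\<sigma> g) q"
      by (simp_all add: slot_sigma_def slot_mu_def slot_Lambda_def scale_tractor_def g c)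
    have H: "nabla1 g c (\<lambda>q d. pd c d (\<sigma> g) q) q a b + P g c q $ a $ b * \<sigma> g q
        + bottom_slot A P \<sigma> g q * g c q $ a $ b = 0" if q: "q \<in> fst c" for q a b
    proof -
      have "trace_free g c q (hessian_P g P c \<sigma> q) a b = 0"
        using E g c q unfolding conformal_einstein_def hessian_P_def by blast
      then show ?thesis
        by (simp add: trace_free_def bottom_slot_eq[OF g c q]) (simp add: hessian_P_def)
    qed
    have "nabla1 g c (\<lambda>q d. slot_mu ?I g c q $ d) p a b = nabla1 g c (\<lambda>q d. pd c d (\<sigma> g) q) p a b" for b
      unfolding nabla1_def using pd_cong[OF c p \<mu>] \<mu>[OF p] by simp
    then show ?thesis
      using H[OF p] D_Lambda_vanishes[where P = P and p = p, OF C_metric[OF g] c P_tensor[OF g] P_trace[OF g c p]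
          density_smooth[OF g c] bottom_slot_smooth[OF g c] H p]
      by (simp add: D_sigma_def D_mu_def D_Lambda_def \<sigma>' \<Lambda> \<mu>[OF p])
  qed
  then show ?thesis unfolding parallel_def by blast
qed

end


section \<open>Parallel tractors and their scales\<close>

context
  fixes I :: "'m tractor"
  assumes I: "tractor_section A C I" and par: "parallel A C P I"
begin

lemma tractor_scale_density: "weight1_density A C (tractor_scale I)"
  unfolding weight1_density_def tractor_scale_def
proof (intro conjI ballI allI impI)
  fix g \<Omega> p assume "g \<in> C" "conformal_factor A \<Omega>"
  moreover obtain c where "c \<in> A" "p \<in> fst c" using chart_at .
  ultimately show "slot_sigma I (rescale \<Omega> g) p = \<Omega> p * slot_sigma I g p"
    using I unfolding tractor_section_def by blast
next
  fix g assume "g \<notin> C"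
  then show "slot_sigma I g = (\<lambda>p. 0)" using I by (simp add: tractor_section_def slot_sigma_def)
qed (use I in \<open>simp add: tractor_section_def\<close>)

lemma parallel_mu: "g \<in> C \<Longrightarrow> c \<in> A \<Longrightarrow> p \<in> fst c \<Longrightarrow> slot_mu I g c p $ a = pd c a (slot_sigma I g) p"
  using par unfolding parallel_def D_sigma_def by force

text \<open>The first slot of the parallel equation identifies \<open>\<mu>\<close> with \<open>d\<sigma>\<close>, so the second slot is a
  statement about \<open>\<sigma>\<close> and \<open>\<Lambda>\<close> alone. Its trace-free part is the conformal Einstein equation and its
  trace determines \<open>\<Lambda>\<close>.\<close>

lemma parallel_hessian_P:
  assumes g: "g \<in> C" and c: "c \<in> A" "p \<in> fst c"
  shows "hessian_P g P c (tractor_scale I) p a b = - slot_Lambda I g p * g c p $ a $ b"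
proof -
  have "nabla1 g c (\<lambda>q d. slot_mu I g c q $ d) p a b = nabla1 g c (\<lambda>q d. pd c d (slot_sigma I g) q) p a b"
    unfolding nabla1_def using pd_cong[OF c parallel_mu[OF g c(1)]] parallel_mu[OF g c] by simp
  moreover have "D_mu g P I c p a b = 0" using par g c unfolding parallel_def by blast
  ultimately show ?thesis by (simp add: D_mu_def hessian_P_def tractor_scale_def)
qed

lemma parallel_trace_hessian_P:
  assumes g: "g \<in> C" and c: "c \<in> A" "p \<in> fst c"
  shows "trace_wrt g c p (hessian_P g P c (tractor_scale I) p) = - 2 * slot_Lambda I g p"
proof -
  have "trace_wrt g c p (hessian_P g P c (tractor_scale I) p)
     = trace_wrt g c p (\<lambda>a b. - slot_Lambda I g p * g c p $ a $ b)"
    by (rule arg_cong[where f = "trace_wrt g c p"]) (simp add: fun_eq_iff parallel_hessian_P[OF g c])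
  then show ?thesis unfolding trace_wrt_scale trace_wrt_self[OF g c] by simp
qed

lemma parallel_conformal_einstein: "conformal_einstein A C P (tractor_scale I)"
proof -
  have "trace_free g c p (hessian_P g P c (tractor_scale I) p) a b = 0"
    if "g \<in> C" "c \<in> A" "p \<in> fst c" for g c p a b
    by (simp add: trace_free_def parallel_hessian_P[OF that] parallel_trace_hessian_P[OF that])
  then show ?thesis unfolding conformal_einstein_def hessian_P_def by blast
qed

lemma parallel_eq_scale_tractor:
  assumes nv: "nowhere_vanishing C (tractor_scale I)"
  shows "scale_tractor A C P (tractor_scale I) = I"
proof
  fix g
  show "scale_tractor A C P (tractor_scale I) g = I g"
  proof (cases "g \<in> C")
    case g: True
    have "one_form A (slot_mu I g)" using I g unfolding tractor_section_def by blast
    then have "slot_mu I g c p = 0" if "c \<notin> A \<or> p \<notin> fst c" for c p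
      using that unfolding one_form_def by blast
    then have \<mu>: "(\<lambda>c p. if c \<in> A \<and> p \<in> fst c then \<chi> a. pd c a (slot_sigma I g) p else 0) = slot_mu I g"
      using parallel_mu[OF g] by (intro ext) (auto simp: vec_eq_iff)
    have \<Lambda>: "bottom_slot A P (tractor_scale I) g = slot_Lambda I g"
    proof
      fix p
      obtain c where c: "c \<in> A" "p \<in> fst c" using chart_at .
      show "bottom_slot A P (tractor_scale I) g p = slot_Lambda I g p"
        by (simp add: bottom_slot_eq[OF tractor_scale_density nv g c] parallel_trace_hessian_P[OF g c])
    qed
    have \<sigma>: "tractor_scale I g = slot_sigma I g" by (simp add: tractor_scale_def)
    have "scale_tractor A C P (tractor_scale I) g = (slot_sigma I g, slot_mu I g, slot_Lambda I g)"
      unfolding scale_tractor_def if_P[OF g] \<Lambda> unfolding \<sigma> \<mu> ..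
    then show ?thesis by (simp add: slot_sigma_def slot_mu_def slot_Lambda_def)
  next
    case False
    then show ?thesis using I by (simp add: scale_tractor_def tractor_section_def)
  qed
qed

end

end

theorem proposition5p2:
  fixes A :: "'m::{t2_space,second_countable_topology} chart set"
    and C :: "'m metric set"
    and P :: "'m metric \<Rightarrow> 'm bilinear_field"
  assumes "moebius_surface A C P"
  shows "bij_betw tractor_scale
    {I. tractor_section A C I \<and> parallel A C P I \<and> nowhere_vanishing C (tractor_scale I)}
    {\<sigma>. weight1_density A C \<sigma> \<and> nowhere_vanishing C \<sigma> \<and> conformal_einstein A C P \<sigma>}"
proof -
  interpret moebius_surface A C P by fact
  have scale: "tractor_scale (scale_tractor A C P \<sigma>) = \<sigma>" if "weight1_density A C \<sigma>" for \<sigma>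
    using that by (auto simp: fun_eq_iff tractor_scale_def slot_sigma_def scale_tractor_def weight1_density_def)
  show ?thesis
  proof (rule bij_betw_byWitness[where f' = "scale_tractor A C P"])
  qed (auto simp: scale parallel_eq_scale_tractor tractor_scale_density parallel_conformal_einstein
        scale_tractor_section scale_tractor_parallel)
qed

end
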